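(* Let $\hat q_1,\hat q_2,g_1,g_2$ be smooth complex-valued functions of $(\xi,\eta,t)$. Consider the overdetermined linear system for the unknown functions $\psi=\psi(\xi,\eta,t)$, $\varphi=\varphi(\xi,\eta,t)$: \[ \psi_{\xi}=-\tfrac12\hat q_1\varphi,\qquad \varphi_{\eta}=-\tfrac12\hat q_2\psi, \] \[ i\psi_{t}=\psi_{\xi\xi}-\psi_{\eta\eta}-g_1\psi+\hat q_{1,\xi}\varphi,\qquad i\varphi_{t}=\varphi_{\xi\xi}-\varphi_{\eta\eta}+g_2\varphi-\hat q_{2,\eta}\psi . \] This system is consistent (i.e. the cross-differentiation conditions $(\psi_\xi)_t=(\psi_t)_\xi$ and $(\varphi_\eta)_t=(\varphi_t)_\eta$ hold identically by virtue of the system) if and only if \[ i\hat q_{1,t}+\hat q_{1,\xi\xi}+\hat q_{1,\eta\eta}+\hat q_1(g_1+g_2)=0,\qquad -i\hat q_{2,t}+\hat q_{2,\xi\xi}+\hat q_{2,\eta\eta}+\hat q_2(g_1+g_2)=0, \] \[ \frac{\partial g_1}{\partial\xi}=-\frac12\frac{\partial}{\partial\eta}(\hat q_1\hat q_2),\qquad \frac{\partial g_2}{\partial\eta}=-\frac12\frac{\partial}{\partial\xi}(\hat q_1\hat q_2). \]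
   Context: Subscripts denote partial derivatives. In the paper this system is written for every integer $n$ with $\psi=\psi_{2n-1}$, $\varphi=\varphi_{2n}$, $\hat q_j=\hat q_j(n)$, $g_j=g_j(n)$; the statement holds for each $n$ separately, so the index is suppressed here. *)

theory Defs
  imports "HOL-Analysis.Analysis"
begin

type_synonym fn3 = "real \<Rightarrow> real \<Rightarrow> real \<Rightarrow> complex"

datatype dir = Xi | Eta | Tm

definition pxi :: "fn3 \<Rightarrow> fn3" where
  "pxi F = (\<lambda>x y t. vector_derivative (\<lambda>s. F s y t) (at x))"
definition peta :: "fn3 \<Rightarrow> fn3" where
  "peta F = (\<lambda>x y t. vector_derivative (\<lambda>s. F x s t) (at y))"
definition pt :: "fn3 \<Rightarrow> fn3" where
  "pt F = (\<lambda>x y t. vector_derivative (\<lambda>s. F x y s) (at t))"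

fun pdir :: "dir \<Rightarrow> fn3 \<Rightarrow> fn3" where
  "pdir Xi F = pxi F"
| "pdir Eta F = peta F"
| "pdir Tm F = pt F"

definition pds :: "dir list \<Rightarrow> fn3 \<Rightarrow> fn3" where
  "pds ds F = foldr pdir ds F"

definition pdiff :: "dir \<Rightarrow> fn3 \<Rightarrow> bool" where
  "pdiff d F \<longleftrightarrow> (\<forall>x y t. case d of
      Xi \<Rightarrow> (\<lambda>s. F s y t) differentiable (at x)
    | Eta \<Rightarrow> (\<lambda>s. F x s t) differentiable (at y)
    | Tm \<Rightarrow> (\<lambda>s. F x y s) differentiable (at t))"

definition smooth3 :: "fn3 \<Rightarrow> bool" where
  "smooth3 F \<longleftrightarrow> (\<forall>ds. continuous_on UNIV (\<lambda>(x,y,t). pds ds F x y t)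
                       \<and> (\<forall>d. pdiff d (pds ds F)))"

text \<open>Consistency of the overdetermined linear system: for every smooth pair
  (psi, phi) satisfying the two first-order (spatial) equations, with the time
  derivatives prescribed by the two evolution equations, the cross-differentiation
  conditions (psi_xi)_t = (psi_t)_xi and (phi_eta)_t = (phi_t)_eta hold identically,
  where (psi_xi)_t is computed by differentiating -q1 phi/2 in t and replacing phi_t
  by its prescribed value (similarly for phi).\<close>
definition consistent :: "fn3 \<Rightarrow> fn3 \<Rightarrow> fn3 \<Rightarrow> fn3 \<Rightarrow> bool" where
  "consistent q1 q2 g1 g2 \<longleftrightarrow>
    (\<forall>\<psi> \<phi>. smooth3 \<psi> \<and> smooth3 \<phi>
       \<and> (\<forall>x y t. pxi \<psi> x y t = - (1/2) * q1 x y t * \<phi> x y t)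
       \<and> (\<forall>x y t. peta \<phi> x y t = - (1/2) * q2 x y t * \<psi> x y t)
     \<longrightarrow> (let \<Psi>t = (\<lambda>x y t. - \<i> * (pxi (pxi \<psi>) x y t - peta (peta \<psi>) x y t
                              - g1 x y t * \<psi> x y t + pxi q1 x y t * \<phi> x y t));
              \<Phi>t = (\<lambda>x y t. - \<i> * (pxi (pxi \<phi>) x y t - peta (peta \<phi>) x y t
                              + g2 x y t * \<phi> x y t - peta q2 x y t * \<psi> x y t))
          in (\<forall>x y t. pxi \<Psi>t x y t
                     = - (1/2) * (pt q1 x y t * \<phi> x y t + q1 x y t * \<Phi>t x y t))
           \<and> (\<forall>x y t. peta \<Phi>t x y t
                     = - (1/2) * (pt q2 x y t * \<psi> x y t + q2 x y t * \<Psi>t x y t))))"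

end

theory Submission
  imports Defs
begin

text \<open>
  Eliminating derivatives by means of the system, the defects of the two cross-differentiation
  conditions become \<open>- \<i> (\<phi> E1 / 2 - \<psi> G1)\<close> and \<open>\<i> (\<psi> E2 / 2 - \<phi> G2)\<close>, where \<open>E1\<close>, \<open>E2\<close>, \<open>G1\<close>, \<open>G2\<close>
  are the left-hand sides of the four equations on the coefficients. This settles one direction.
  For the other, \<open>(\<psi>, \<phi>)\<close> must take the values \<open>(1, 0)\<close> and \<open>(0, 1)\<close> at any prescribed point
  \<open>(c, d, t)\<close>. Such solutions come from the Goursat problem
  \<open>\<psi> = \<alpha> - 1/2 \<integral>\<^bsub>c\<^esub>\<^bsup>\<xi>\<^esup> q1 \<phi>\<close>, \<open>\<phi> = \<beta> - 1/2 \<integral>\<^bsub>d\<^esub>\<^bsup>\<eta>\<^esup> q2 \<psi>\<close>, solved by Picard iteration. Since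
  \<open>(\<psi>\<^sub>t, \<phi>\<^sub>t)\<close> solves a problem of the same kind whose data involve only \<open>\<psi>\<close> and \<open>\<phi>\<close>,
  and the other derivatives are read off the integral equations, smoothness follows by induction.
\<close>

subsection \<open>Functions of three variables with continuous partial derivatives\<close>

text \<open>A relational form fixes existence and value of the derivative at once. The functions
  \<open>pxi\<close>, \<open>peta\<close>, \<open>pt\<close> rest on
  \<open>vector_derivative\<close>, which says nothing useful where differentiability fails.\<close>

definition has_partial :: "dir \<Rightarrow> fn3 \<Rightarrow> fn3 \<Rightarrow> bool" where
  "has_partial d F G \<longleftrightarrow> (\<forall>x y t. case d of
      Xi \<Rightarrow> ((\<lambda>s. F s y t) has_vector_derivative G x y t) (at x)
    | Eta \<Rightarrow> ((\<lambda>s. F x s t) has_vector_derivative G x y t) (at y)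
    | Tm \<Rightarrow> ((\<lambda>s. F x y s) has_vector_derivative G x y t) (at t))"

definition cont3 :: "fn3 \<Rightarrow> bool" where
  "cont3 F \<longleftrightarrow> continuous_on UNIV (\<lambda>(x,y,t). F x y t)"

text \<open>This is C^k regularity with existentially quantified partials: an induction on the order
  may offer any explicit formula as derivative, without first computing \<open>pdir\<close>. All
  mixed partials up to order k are covered.\<close>

fun class_C :: "nat \<Rightarrow> fn3 \<Rightarrow> bool" where
  "class_C 0 F \<longleftrightarrow> cont3 F"
| "class_C (Suc k) F \<longleftrightarrow> cont3 F \<and> (\<forall>d. \<exists>G. has_partial d F G \<and> class_C k G)"

lemma has_partial_pdir: "has_partial d F G \<Longrightarrow> pdir d F = G"
  by (cases d) (auto simp: has_partial_def pxi_def peta_def pt_def intro!: ext vector_derivative_at)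

lemma has_partial_pdiff: "has_partial d F G \<Longrightarrow> pdiff d F"
  by (cases d) (auto simp: has_partial_def pdiff_def intro: differentiableI_vector)

lemma pdiff_has_partial: "pdiff d F \<Longrightarrow> has_partial d F (pdir d F)"
  by (cases d) (auto simp: has_partial_def pdiff_def pxi_def peta_def pt_def vector_derivative_works)

lemma has_partial_const: "has_partial d (\<lambda>x y t. a) (\<lambda>x y t. 0)"
  by (cases d) (auto simp: has_partial_def)

lemma has_partial_add:
  "\<lbrakk>has_partial d F F'; has_partial d G G'\<rbrakk> \<Longrightarrow>
   has_partial d (\<lambda>x y t. F x y t + G x y t) (\<lambda>x y t. F' x y t + G' x y t)"
  by (cases d) (auto simp: has_partial_def intro!: has_vector_derivative_add)

lemma has_partial_diff:
  "\<lbrakk>has_partial d F F'; has_partial d G G'\<rbrakk> \<Longrightarrow>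
   has_partial d (\<lambda>x y t. F x y t - G x y t) (\<lambda>x y t. F' x y t - G' x y t)"
  by (cases d) (auto simp: has_partial_def intro!: has_vector_derivative_diff)

lemma has_partial_mult:
  "\<lbrakk>has_partial d F F'; has_partial d G G'\<rbrakk> \<Longrightarrow>
   has_partial d (\<lambda>x y t. F x y t * G x y t) (\<lambda>x y t. F' x y t * G x y t + F x y t * G' x y t)"
  by (cases d) (auto simp: has_partial_def add.commute intro!: has_vector_derivative_mult)

lemma cont3D:
  assumes "cont3 F" "continuous_on S a" "continuous_on S b" "continuous_on S c"
  shows "continuous_on S (\<lambda>z. F (a z) (b z) (c z))"
  using continuous_on_compose2[OF assms(1)[unfolded cont3_def]
      continuous_on_Pair[OF assms(2) continuous_on_Pair[OF assms(3,4)]]]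
  by simp

lemma cont3I: "continuous_on UNIV (\<lambda>z. F (fst z) (fst (snd z)) (snd (snd z))) \<Longrightarrow> cont3 F"
  by (simp add: cont3_def case_prod_unfold)

lemma cont3_const: "cont3 (\<lambda>x y t. a)"
  by (rule cont3I) simp

lemma cont3_add: "\<lbrakk>cont3 F; cont3 G\<rbrakk> \<Longrightarrow> cont3 (\<lambda>x y t. F x y t + G x y t)"
  by (rule cont3I) (intro continuous_intros cont3D; simp)

lemma cont3_diff: "\<lbrakk>cont3 F; cont3 G\<rbrakk> \<Longrightarrow> cont3 (\<lambda>x y t. F x y t - G x y t)"
  by (rule cont3I) (intro continuous_intros cont3D; simp)

lemma cont3_mult: "\<lbrakk>cont3 F; cont3 G\<rbrakk> \<Longrightarrow> cont3 (\<lambda>x y t. F x y t * G x y t)"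
  by (rule cont3I) (intro continuous_intros cont3D; simp)

lemmas cont3_intros = cont3_const cont3_add cont3_diff cont3_mult

section \<open>Closure properties of the C^k classes\<close>

lemma class_C_cont3: "class_C k F \<Longrightarrow> cont3 F"
  by (cases k) auto

lemma class_C_SucI:
  "\<lbrakk>cont3 F; \<And>d. \<exists>G. has_partial d F G \<and> class_C k G\<rbrakk> \<Longrightarrow> class_C (Suc k) F"
  by simp

lemma class_C_SucD: "class_C (Suc k) F \<Longrightarrow> \<exists>G. has_partial d F G \<and> class_C k G"
  by simp

lemma class_C_Suc: "class_C (Suc k) F \<Longrightarrow> class_C k F"
proof (induction k arbitrary: F)
  case (Suc k)
  show ?case
  proof (rule class_C_SucI)
    show "cont3 F"
      using Suc.prems by simp
    fix d
    show "\<exists>G. has_partial d F G \<and> class_C k G"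
      using class_C_SucD[OF Suc.prems, of d] Suc.IH by blast
  qed
qed simp

lemma class_C_const: "class_C k (\<lambda>x y t. a)"
  by (induction k arbitrary: a) (auto simp: cont3_const intro: has_partial_const)

lemma class_C_add: "\<lbrakk>class_C k F; class_C k G\<rbrakk> \<Longrightarrow> class_C k (\<lambda>x y t. F x y t + G x y t)"
proof (induction k arbitrary: F G)
  case (Suc k)
  show ?case
  proof (rule class_C_SucI)
    show "cont3 (\<lambda>x y t. F x y t + G x y t)"
      using Suc.prems by (simp add: cont3_add)
    fix d
    show "\<exists>H. has_partial d (\<lambda>x y t. F x y t + G x y t) H \<and> class_C k H"
      using Suc.prems[THEN class_C_SucD, of d] Suc.IH has_partial_add by blast
  qed
qed (simp add: cont3_add)

text \<open>The product rule leaves one factor undifferentiated in each summand, so besides the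
  partials also \<open>F\<close> and \<open>G\<close> themselves are needed at the lower order k;
  \<open>class_C_Suc\<close> supplies this.\<close>

lemma class_C_mult: "\<lbrakk>class_C k F; class_C k G\<rbrakk> \<Longrightarrow> class_C k (\<lambda>x y t. F x y t * G x y t)"
proof (induction k arbitrary: F G)
  case (Suc k)
  have k: "class_C k F" "class_C k G"
    using Suc.prems class_C_Suc by blast+
  have "\<exists>H. has_partial d (\<lambda>x y t. F x y t * G x y t) H \<and> class_C k H" for d
  proof -
    obtain F' G' where "has_partial d F F'" "class_C k F'" "has_partial d G G'" "class_C k G'"
      using Suc.prems[THEN class_C_SucD, of d] by blast
    then show ?thesis
      using has_partial_mult[of d F F' G G'] class_C_add Suc.IH k by blast
  qed
  then show ?case
    using Suc.prems by (auto intro: cont3_mult)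
qed (simp add: cont3_mult)

section \<open>Smoothness as membership in every C^k class\<close>

lemma smooth3_pdir: "smooth3 F \<Longrightarrow> smooth3 (pdir d F)"
  unfolding smooth3_def
proof (intro allI)
  fix ds assume *: "\<forall>ds. continuous_on UNIV (\<lambda>(x, y, t). pds ds F x y t) \<and> (\<forall>d. pdiff d (pds ds F))"
  show "continuous_on UNIV (\<lambda>(x, y, t). pds ds (pdir d F) x y t) \<and> (\<forall>e. pdiff e (pds ds (pdir d F)))"
    \<comment> \<open>\<open>pds\<close> folds from the right, so the last entry of the list is the
      derivative applied first.\<close>
    using *[rule_format, of "ds @ [d]"] by (simp add: pds_def)
qed

lemma smooth3_cont3: "smooth3 F \<Longrightarrow> cont3 F"
  unfolding smooth3_def cont3_def by (metis foldr_Nil id_apply pds_def)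

lemma smooth3_has_partial: "smooth3 F \<Longrightarrow> has_partial d F (pdir d F)"
  unfolding smooth3_def by (metis foldr_Nil id_apply pds_def pdiff_has_partial)

text \<open>Partial derivatives are unique, so the witnesses hidden in \<open>class_C\<close> must
  be the functions \<open>pdir d F\<close>. This makes smoothness of the Goursat solutions
  accessible to induction on the order.\<close>

lemma smooth3_iff_class_C: "smooth3 F \<longleftrightarrow> (\<forall>k. class_C k F)"
proof
  assume "smooth3 F"
  have "smooth3 G \<Longrightarrow> class_C k G" for k G
  proof (induction k arbitrary: G)
    case (Suc k)
    show ?case
      by (rule class_C_SucI)
         (use Suc smooth3_cont3 smooth3_has_partial smooth3_pdir in blast)+
  qed (simp add: smooth3_cont3)
  then show "\<forall>k. class_C k F"
    using \<open>smooth3 F\<close> by blast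
next
  assume F: "\<forall>k. class_C k F"
  have "\<forall>k. class_C k (pds ds F)" for ds
  proof (induction ds)
    case (Cons d ds)
    have "class_C k (pdir d (pds ds F))" for k
      using class_C_SucD[OF Cons[rule_format, of "Suc k"], of d] has_partial_pdir by blast
    then show ?case
      by (simp add: pds_def)
  qed (use F in \<open>simp add: pds_def\<close>)
  then show "smooth3 F"
    unfolding smooth3_def cont3_def[symmetric]
    using class_C_cont3 class_C_SucD has_partial_pdiff by blast
qed

lemma smooth3_mult: "\<lbrakk>smooth3 F; smooth3 G\<rbrakk> \<Longrightarrow> smooth3 (\<lambda>x y t. F x y t * G x y t)"
  by (simp add: smooth3_iff_class_C class_C_mult)

lemma smooth3_const: "smooth3 (\<lambda>x y t. a)"
  by (simp add: smooth3_iff_class_C class_C_const)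

subsection \<open>Integration along a coordinate\<close>

text \<open>The oriented integral of \<open>F\<close> from \<open>c\<close> to \<open>x\<close> in the first variable, rescaled to the fixed
  interval \<open>[0,1]\<close> so that the theorems on integrals with parameters apply directly.\<close>
definition int_xi :: "real \<Rightarrow> fn3 \<Rightarrow> fn3" where
  "int_xi c F = (\<lambda>x y t. integral (cbox 0 1) (\<lambda>s::real. (x - c) *\<^sub>R F (c + s * (x - c)) y t))"

text \<open>Exchanging the first two variables transfers every fact about integration in \<xi> to
  \<eta>, and later turns one cross-differentiation condition into the other.\<close>

definition swap :: "fn3 \<Rightarrow> fn3" where
  "swap F = (\<lambda>x y t. F y x t)"

definition int_eta :: "real \<Rightarrow> fn3 \<Rightarrow> fn3" where
  "int_eta c F = swap (int_xi c (swap F))"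

fun swap_dir :: "dir \<Rightarrow> dir" where
  "swap_dir Xi = Eta" | "swap_dir Eta = Xi" | "swap_dir Tm = Tm"

lemma swap_swap [simp]: "swap (swap F) = F"
  by (simp add: swap_def)

lemma swap_dir_swap_dir [simp]: "swap_dir (swap_dir d) = d"
  by (cases d) auto

lemma has_partial_swap: "has_partial d F G \<Longrightarrow> has_partial (swap_dir d) (swap F) (swap G)"
  by (cases d) (auto simp: has_partial_def swap_def)

lemma cont3_swap: "cont3 F \<Longrightarrow> cont3 (swap F)"
  unfolding swap_def by (rule cont3I) (intro continuous_intros cont3D; simp)

lemma class_C_swap: "class_C k F \<Longrightarrow> class_C k (swap F)"
proof (induction k arbitrary: F)
  case (Suc k)
  show ?case
  proof (rule class_C_SucI)
    show "cont3 (swap F)"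
      using Suc.prems by (simp add: cont3_swap)
    fix d
    obtain G where "has_partial (swap_dir d) F G" "class_C k G"
      using class_C_SucD[OF Suc.prems] by blast
    then show "\<exists>H. has_partial d (swap F) H \<and> class_C k H"
      using has_partial_swap[of "swap_dir d" F G] Suc.IH by auto
  qed
qed (simp add: cont3_swap)

section \<open>The fundamental theorem and differentiation under the integral\<close>

lemma segment_in_interval:
  fixes a b c x s :: real
  assumes "c \<in> {a..b}" "x \<in> {a..b}" "s \<in> {0..1}"
  shows "c + s * (x - c) \<in> {a..b}"
proof -
  have "(1 - s) *\<^sub>R c + s *\<^sub>R x \<in> {a..b}"
    by (rule convexD[OF convex_real_interval(5)]) (use assms in auto)
  then show ?thesis by (simp add: algebra_simps)
qed

text \<open>Substitute u = c + s (x - c) and apply the fundamental theorem in s on [0,1]. Both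
  orders of \<open>c\<close> and \<open>x\<close> are covered, the factor x - c carrying the
  orientation.\<close>

lemma integral_segment_antiderivative:
  fixes f g :: "real \<Rightarrow> complex"
  assumes g: "\<And>u. u \<in> {a..b} \<Longrightarrow> (g has_vector_derivative f u) (at u within {a..b})"
    and cx: "c \<in> {a..b}" "x \<in> {a..b}"
  shows "integral (cbox 0 1) (\<lambda>s::real. (x - c) *\<^sub>R f (c + s * (x - c))) = g x - g c"
proof -
  have "((g \<circ> (\<lambda>s. c + s * (x - c))) has_vector_derivative (x - c) *\<^sub>R f (c + s * (x - c)))
        (at s within {0..1})" if s: "s \<in> {0..1}" for s
  proof (rule vector_diff_chain_within)
    show "((\<lambda>s. c + s * (x - c)) has_vector_derivative x - c) (at s within {0..1})"
      by (auto intro!: derivative_eq_intros simp: has_real_derivative_iff_has_vector_derivative[symmetric])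
    show "(g has_vector_derivative f (c + s * (x - c)))
       (at (c + s * (x - c)) within (\<lambda>s. c + s * (x - c)) ` {0..1})"
      by (rule has_vector_derivative_within_subset[OF g])
         (use s cx segment_in_interval in blast)+
  qed
  from fundamental_theorem_of_calculus[OF zero_le_one this]
  have "((\<lambda>s. (x - c) *\<^sub>R f (c + s * (x - c))) has_integral g x - g c) {0..1}"
    by (simp add: o_def)
  from integral_unique[OF this] show ?thesis
    unfolding box_real .
qed

lemma int_xi_base [simp]: "int_xi c F c y t = 0"
  by (simp add: int_xi_def)

lemma int_xi_cont3:
  assumes "cont3 F"
  shows "cont3 (int_xi c F)"
  unfolding int_xi_def
  by (rule cont3I, rule integral_continuous_on_param)
     (simp add: case_prod_unfold, intro continuous_intros cont3D[OF assms])

lemma int_xi_has_partial_Xi: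
  assumes "cont3 F"
  shows "has_partial Xi (int_xi c F) F"
  unfolding has_partial_def
proof (clarsimp)
  fix x y t
  \<comment> \<open>The margin 1 puts x in the interior of [a,b], so that the one-variable
    antiderivative on [a,b] has a two-sided derivative at x; \<open>c\<close> lies in [a,b] as
    well.\<close>
  define a where "a = min c x - 1"
  define b where "b = max c x + 1"
  have "continuous_on {a..b} (\<lambda>s. F s y t)"
    by (intro cont3D[OF assms] continuous_intros)
  then obtain g where g: "\<And>u. u \<in> {a..b} \<Longrightarrow>
      (g has_vector_derivative F u y t) (at u within {a..b})"
    using antiderivative_continuous by blast
  have x: "x \<in> {a<..<b}" and c: "c \<in> {a..b}"
    by (auto simp: a_def b_def)
  have "(g has_vector_derivative F x y t) (at x)"
    using g[of x] x by (metis at_within_Icc_at greaterThanLessThan_iff less_imp_le atLeastAtMost_iff)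
  then have "((\<lambda>s. g s - g c) has_vector_derivative F x y t) (at x)"
    by (auto intro!: derivative_eq_intros)
  then show "((\<lambda>s. int_xi c F s y t) has_vector_derivative F x y t) (at x)"
  proof (rule has_vector_derivative_transform_within_open[OF _ open_greaterThanLessThan x])
    fix s assume "s \<in> {a<..<b}"
    then show "g s - g c = int_xi c F s y t"
      unfolding int_xi_def
      using integral_segment_antiderivative[OF g c, of s] by simp
  qed
qed

lemma int_xi_fundamental:
  assumes "has_partial Xi F G"
  shows "F x y t = F c y t + int_xi c G x y t"
proof -
  have "((\<lambda>s. F s y t) has_vector_derivative G u y t) (at u within S)" for u S
    using assms by (auto simp: has_partial_def intro: has_vector_derivative_at_within)
  from integral_segment_antiderivative[OF this, of c "min c x" "max c x" x]
  show ?thesis by (simp add: int_xi_def)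
qed

text \<open>For directions other than \<open>Xi\<close> the Leibniz rule applies: the domain of
  integration is the fixed interval [0,1] and the scaling factor x - c is constant in the
  parameter.\<close>

lemma int_xi_has_partial_param:
  assumes F: "cont3 F" and G: "cont3 G" and d: "has_partial d F G" "d \<noteq> Xi"
  shows "has_partial d (int_xi c F) (int_xi c G)"
proof -
  have e: "((\<lambda>s. int_xi c F x s t) has_vector_derivative int_xi c G x y t) (at y)" if "d = Eta" for x y t
    unfolding int_xi_def
  proof (rule leibniz_rule_vector_derivative[where U=UNIV])
    fix u s :: real
    show "((\<lambda>u. (x - c) *\<^sub>R F (c + s * (x - c)) u t) has_vector_derivative
           (x - c) *\<^sub>R G (c + s * (x - c)) u t) (at u)"
      using d that by (auto simp: has_partial_def intro!: derivative_eq_intros)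
    show "(\<lambda>s. (x - c) *\<^sub>R F (c + s * (x - c)) u t) integrable_on cbox 0 1"
      by (intro integrable_continuous continuous_intros cont3D[OF F])
    show "continuous_on (UNIV \<times> cbox 0 1) (\<lambda>(u, s). (x - c) *\<^sub>R G (c + s * (x - c)) u t)"
      unfolding case_prod_unfold by (intro continuous_intros cont3D[OF G])
  qed auto
  have t: "((\<lambda>s. int_xi c F x y s) has_vector_derivative int_xi c G x y t) (at t)" if "d = Tm" for x y t
    unfolding int_xi_def
  proof (rule leibniz_rule_vector_derivative[where U=UNIV])
    fix u s :: real
    show "((\<lambda>u. (x - c) *\<^sub>R F (c + s * (x - c)) y u) has_vector_derivative
           (x - c) *\<^sub>R G (c + s * (x - c)) y u) (at u)"
      using d that by (auto simp: has_partial_def intro!: derivative_eq_intros)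
    show "(\<lambda>s. (x - c) *\<^sub>R F (c + s * (x - c)) y u) integrable_on cbox 0 1"
      by (intro integrable_continuous continuous_intros cont3D[OF F])
    show "continuous_on (UNIV \<times> cbox 0 1) (\<lambda>(u, s). (x - c) *\<^sub>R G (c + s * (x - c)) y u)"
      unfolding case_prod_unfold by (intro continuous_intros cont3D[OF G])
  qed auto
  show ?thesis
    using d(2) e t by (cases d) (auto simp: has_partial_def)
qed

lemma int_xi_diff:
  assumes "cont3 F" "cont3 G"
  shows "int_xi c (\<lambda>x y t. F x y t - G x y t) x y t = int_xi c F x y t - int_xi c G x y t"
  unfolding int_xi_def scaleR_diff_right
  by (rule integral_diff; intro integrable_continuous continuous_intros cont3D[OF assms(1)] cont3D[OF assms(2)])

lemma int_xi_add:
  assumes "cont3 F" "cont3 G"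
  shows "int_xi c (\<lambda>x y t. F x y t + G x y t) x y t = int_xi c F x y t + int_xi c G x y t"
  unfolding int_xi_def scaleR_add_right
  by (rule integral_add; intro integrable_continuous continuous_intros cont3D[OF assms(1)] cont3D[OF assms(2)])

text \<open>The \<xi>-derivative gives back \<open>F\<close>, which has the lower order by
  monotonicity; the other derivatives pass under the integral, where the induction hypothesis
  applies.\<close>

lemma int_xi_class_C: "class_C k F \<Longrightarrow> class_C k (int_xi c F)"
proof (induction k arbitrary: F)
  case (Suc k)
  have "\<exists>G. has_partial d (int_xi c F) G \<and> class_C k G" for d
  proof (cases "d = Xi")
    case True
    then show ?thesis
      using Suc.prems class_C_Suc class_C_cont3 int_xi_has_partial_Xi by blast
  next
    case False
    then show ?thesis
      using class_C_SucD[OF Suc.prems, of d] Suc.IH class_C_cont3[OF Suc.prems] class_C_cont3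
        int_xi_has_partial_param by blast
  qed
  then show ?case
    using Suc.prems by (simp add: int_xi_cont3)
qed (simp add: int_xi_cont3)

text \<open>Integrating the weight exp (l r) from 0 produces a factor 1/l. This gain is what makes
  the iteration contract on boxes of any size.\<close>

lemma int_xi_exp_bound:
  assumes F: "cont3 F" and l: "l > 0"
    and bd: "\<And>s. s \<in> {0..1} \<Longrightarrow>
      norm (F (c + s * (x - c)) y t) \<le> K * exp (l * \<bar>c + s * (x - c) - c\<bar>)"
    and K: "K \<ge> 0"
  shows "norm (int_xi c F x y t) \<le> K / l * exp (l * \<bar>x - c\<bar>)"
proof -
  define r where "r = \<bar>x - c\<bar>"
  \<comment> \<open>The antiderivative in s of the majorant is K / l * exp (l s r), written at the
    end points 1 and 0 in the shape required by the fundamental theorem.\<close>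
  have I: "((\<lambda>s. r * (K * exp (l * (s * r)))) has_integral
        K / l * exp (l * (1 * r)) - K / l * exp (l * (0 * r))) {0..1}"
    by (rule fundamental_theorem_of_calculus)
       (use l in \<open>auto intro!: derivative_eq_intros
          simp: has_real_derivative_iff_has_vector_derivative[symmetric]\<close>)
  have "norm (int_xi c F x y t) \<le> integral {0..1} (\<lambda>s. r * (K * exp (l * (s * r))))"
    unfolding int_xi_def box_real
  proof (rule integral_norm_bound_integral)
    show "(\<lambda>s. (x - c) *\<^sub>R F (c + s * (x - c)) y t) integrable_on {0..1}"
      unfolding box_real[symmetric] by (intro integrable_continuous continuous_intros cont3D[OF F])
    show "(\<lambda>s. r * (K * exp (l * (s * r)))) integrable_on {0..1}"
      using I by blast
    fix s :: real assume s: "s \<in> {0..1}"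
    then show "norm ((x - c) *\<^sub>R F (c + s * (x - c)) y t) \<le> r * (K * exp (l * (s * r)))"
      using bd[OF s] by (auto simp: r_def abs_mult intro!: mult_left_mono)
  qed
  also have "\<dots> = K / l * exp (l * r) - K / l"
    using integral_unique[OF I] by simp
  also have "\<dots> \<le> K / l * exp (l * r)"
    using K l by simp
  finally show ?thesis by (simp add: r_def)
qed

subsection \<open>Series converging geometrically on boxes\<close>

definition in_box :: "real \<Rightarrow> real \<Rightarrow> real \<Rightarrow> real \<Rightarrow> bool" where
  "in_box R x y t \<longleftrightarrow> x \<in> {-R..R} \<and> y \<in> {-R..R} \<and> t \<in> {-R..R}"

lemma in_box_mono: "\<lbrakk>in_box R x y t; R \<le> S\<rbrakk> \<Longrightarrow> in_box S x y t"
  by (auto simp: in_box_def)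

lemma in_box_exhaust: obtains R where "in_box R x y t"
proof
  show "in_box (max \<bar>x\<bar> (max \<bar>y\<bar> \<bar>t\<bar>)) x y t"
    by (auto simp: in_box_def)
qed

lemma cont3_bounded_on_box:
  assumes "cont3 F"
  obtains B where "B \<ge> 0" "\<And>x y t. in_box R x y t \<Longrightarrow> norm (F x y t) \<le> B"
proof -
  have "compact ({-R..R} \<times> {-R..R} \<times> {-R..R})"
    by (intro compact_Times compact_Icc)
  then have "bounded ((\<lambda>(x, y, t). F x y t) ` ({-R..R} \<times> {-R..R} \<times> {-R..R}))"
    by (intro compact_imp_bounded compact_continuous_image
        continuous_on_subset[OF assms[unfolded cont3_def] subset_UNIV])
  then obtain B where B: "\<And>p. p \<in> {-R..R} \<times> {-R..R} \<times> {-R..R} \<Longrightarrow> norm (case p of (x, y, t) \<Rightarrow> F x y t) \<le> B"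
    unfolding bounded_iff by blast
  show thesis
  proof
    show "max 0 B \<ge> 0" by simp
    show "norm (F x y t) \<le> max 0 B" if "in_box R x y t" for x y t
      using B[of "(x, y, t)"] that by (auto simp: in_box_def)
  qed
qed

text \<open>Only the constant \<open>K\<close> depends on the box; the ratio 1/2 is the same
  everywhere. The series then converges uniformly on every box, which suffices for local properties
  of the sum.\<close>

definition geometric_on_boxes :: "(nat \<Rightarrow> fn3) \<Rightarrow> bool" where
  "geometric_on_boxes a \<longleftrightarrow>
     (\<forall>R. \<exists>K. \<forall>n x y t. in_box R x y t \<longrightarrow> norm (a n x y t) \<le> K * (1/2) ^ n)"

definition series :: "(nat \<Rightarrow> fn3) \<Rightarrow> fn3" where
  "series a = (\<lambda>x y t. \<Sum>n. a n x y t)"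

lemma geometric_on_boxes_mult:
  assumes "cont3 F" "geometric_on_boxes a"
  shows "geometric_on_boxes (\<lambda>n x y t. F x y t * a n x y t)"
  unfolding geometric_on_boxes_def
proof
  fix R
  obtain B where B: "B \<ge> 0" "\<And>x y t. in_box R x y t \<Longrightarrow> norm (F x y t) \<le> B"
    using cont3_bounded_on_box[OF assms(1)] by metis
  obtain K where K: "\<And>n x y t. in_box R x y t \<Longrightarrow> norm (a n x y t) \<le> K * (1/2) ^ n"
    using assms(2) unfolding geometric_on_boxes_def by meson
  have "norm (F x y t * a n x y t) \<le> B * K * (1/2) ^ n" if "in_box R x y t" for n x y t
    unfolding norm_mult mult.assoc by (intro mult_mono B K that norm_ge_zero)
  then show "\<exists>K. \<forall>n x y t. in_box R x y t \<longrightarrow> norm (F x y t * a n x y t) \<le> K * (1/2) ^ n"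
    by blast
qed

lemma geometric_on_boxes_add:
  assumes "geometric_on_boxes a" "geometric_on_boxes b"
  shows "geometric_on_boxes (\<lambda>n x y t. a n x y t + b n x y t)"
  unfolding geometric_on_boxes_def
proof
  fix R
  obtain K where K: "\<And>n x y t. in_box R x y t \<Longrightarrow> norm (a n x y t) \<le> K * (1/2) ^ n"
    using assms(1) unfolding geometric_on_boxes_def by meson
  obtain L where L: "\<And>n x y t. in_box R x y t \<Longrightarrow> norm (b n x y t) \<le> L * (1/2) ^ n"
    using assms(2) unfolding geometric_on_boxes_def by meson
  have "norm (a n x y t + b n x y t) \<le> (K + L) * (1/2) ^ n" if "in_box R x y t" for n x y t
    unfolding distrib_right by (intro norm_triangle_mono K L that)
  then show "\<exists>K. \<forall>n x y t. in_box R x y t \<longrightarrow> norm (a n x y t + b n x y t) \<le> K * (1/2) ^ n"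
    by blast
qed

lemma geometric_on_boxes_Suc:
  assumes "geometric_on_boxes a"
  shows "geometric_on_boxes (\<lambda>n. a (Suc n))"
  unfolding geometric_on_boxes_def
proof
  fix R
  obtain K where K: "\<And>n x y t. in_box R x y t \<Longrightarrow> norm (a n x y t) \<le> K * (1/2) ^ n"
    using assms(1) unfolding geometric_on_boxes_def by meson
  have "norm (a (Suc n) x y t) \<le> (K / 2) * (1/2) ^ n" if "in_box R x y t" for n x y t
    using K[OF that, of "Suc n"] by simp
  then show "\<exists>K. \<forall>n x y t. in_box R x y t \<longrightarrow> norm (a (Suc n) x y t) \<le> K * (1/2) ^ n"
    by blast
qed

lemma geometric_on_boxes_swap:
  assumes "geometric_on_boxes a"
  shows "geometric_on_boxes (\<lambda>n. swap (a n))"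
proof -
  have "in_box R x y t \<longleftrightarrow> in_box R y x t" for R x y t
    by (auto simp: in_box_def)
  then show ?thesis
    using assms unfolding geometric_on_boxes_def swap_def by metis
qed

text \<open>A fixed number bounded by \<open>K * (1/2) ^ n\<close> for all n is zero. This is the
  last step of the uniqueness proof for the Goursat problem.\<close>

lemma geometric_on_boxes_const_eq_0:
  assumes "geometric_on_boxes (\<lambda>n. F)"
  shows "F x y t = 0"
proof -
  obtain R where "in_box R x y t"
    by (rule in_box_exhaust)
  then obtain K where K: "\<And>n. norm (F x y t) \<le> K * (1/2) ^ n"
    using assms unfolding geometric_on_boxes_def by blast
  have "(\<lambda>n. K * (1/2) ^ n) \<longlonglongrightarrow> K * 0"
    by (intro tendsto_intros LIMSEQ_power_zero) auto
  then have "norm (F x y t) \<le> K * 0"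
    by (rule LIMSEQ_le_const) (use K in blast)
  then show ?thesis by simp
qed

lemma uniform_limit_series:
  assumes "geometric_on_boxes a"
  shows "uniform_limit {p. in_box R (fst p) (fst (snd p)) (snd (snd p))}
    (\<lambda>n p. \<Sum>i<n. a i (fst p) (fst (snd p)) (snd (snd p)))
    (\<lambda>p. series a (fst p) (fst (snd p)) (snd (snd p))) sequentially"
proof -
  obtain K where K: "\<And>n x y t. in_box R x y t \<Longrightarrow> norm (a n x y t) \<le> K * (1/2) ^ n"
    using assms unfolding geometric_on_boxes_def by meson
  show ?thesis
    unfolding series_def
    by (rule Weierstrass_m_test[where M="\<lambda>n. K * (1/2) ^ n"])
       (auto intro!: K summable_mult summable_geometric)
qed

lemma geometric_on_boxes_sums:
  assumes "geometric_on_boxes a"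
  shows "(\<lambda>n. a n x y t) sums series a x y t"
proof -
  obtain R where "in_box R x y t"
    by (rule in_box_exhaust)
  then show ?thesis
    using tendsto_uniform_limitI[OF uniform_limit_series[OF assms, of R], of "(x, y, t)"]
    by (simp add: sums_def)
qed

section \<open>Continuity, termwise differentiation and termwise integration of series\<close>

lemma series_cont3:
  assumes "geometric_on_boxes a" "\<And>n. cont3 (a n)"
  shows "cont3 (series a)"
proof (rule cont3I)
  let ?B = "\<lambda>R. {p. in_box R (fst p) (fst (snd p)) (snd (snd p))}"
  let ?f = "\<lambda>p. series a (fst p) (fst (snd p)) (snd (snd p))"
  have "isCont ?f p" for p
  proof -
    obtain x y t where p: "p = (x, y, t)" by (metis prod.exhaust)
    obtain R where R: "in_box R x y t" by (rule in_box_exhaust)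
    \<comment> \<open>The radius R + 1 makes p an interior point, so that continuity on the box
      yields continuity at p.\<close>
    have "continuous_on (?B (R + 1)) ?f"
      by (rule uniform_limit_theorem[OF _ uniform_limit_series[OF assms(1)]])
         (auto intro!: always_eventually continuous_intros cont3D[OF assms(2)])
    moreover have "p \<in> {-R-1<..<R+1} \<times> {-R-1<..<R+1} \<times> {-R-1<..<R+1}"
      using R by (auto simp: p in_box_def)
    moreover have "{-R-1<..<R+1} \<times> {-R-1<..<R+1} \<times> {-R-1<..<R+1} \<subseteq> ?B (R + 1)"
      by (auto simp: in_box_def)
    moreover have "open ({-R-1<..<R+1} \<times> {-R-1<..<R+1} \<times> {-R-1<..<R+1})"
      by (intro open_Times open_greaterThanLessThan)
    ultimately show ?thesis
      by (meson continuous_on_eq_continuous_at continuous_on_subset)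
  qed
  then show "continuous_on UNIV ?f"
    by (simp add: continuous_on_eq_continuous_at)
qed

lemma has_vector_derivative_series:
  fixes f f' :: "nat \<Rightarrow> real \<Rightarrow> complex"
  assumes f: "\<And>n u. (f n has_vector_derivative f' n u) (at u)"
    and unif: "uniform_limit {a..b} (\<lambda>n u. \<Sum>i<n. f' i u) g' sequentially"
    and sums: "\<And>u. (\<lambda>n. f n u) sums g u"
    and x: "x \<in> {a<..<b}"
  shows "(g has_vector_derivative g' x) (at x)"
proof -
  have "\<exists>h. \<forall>u\<in>{a..b}. (\<lambda>n. f n u) sums h u \<and>
      (h has_derivative (\<lambda>s. s *\<^sub>R g' u)) (at u within {a..b})"
  proof (rule has_derivative_series[where f'="\<lambda>n u s. s *\<^sub>R f' n u"])
    show "(f n has_derivative (\<lambda>s. s *\<^sub>R f' n u)) (at u within {a..b})" for n u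
      using f[of n u] by (simp add: has_vector_derivative_def has_derivative_at_withinI)
    show "x \<in> {a..b}" using x by simp
    show "(\<lambda>n. f n x) sums g x" by (rule sums)
    fix e :: real assume e: "e > 0"
    from uniform_limitD[OF unif e]
    show "\<forall>\<^sub>F n in sequentially. \<forall>u\<in>{a..b}. \<forall>h. norm ((\<Sum>i<n. h *\<^sub>R f' i u) - h *\<^sub>R g' u) \<le> e * norm h"
    proof (rule eventually_mono, intro ballI allI)
      fix n u h
      assume "\<forall>u\<in>{a..b}. dist (\<Sum>i<n. f' i u) (g' u) < e" "u \<in> {a..b}"
      then have "norm ((\<Sum>i<n. f' i u) - g' u) \<le> e"
        by (auto simp: dist_norm intro: less_imp_le)
      then have "\<bar>h\<bar> * norm ((\<Sum>i<n. f' i u) - g' u) \<le> \<bar>h\<bar> * e"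
        by (intro mult_left_mono) auto
      then show "norm ((\<Sum>i<n. h *\<^sub>R f' i u) - h *\<^sub>R g' u) \<le> e * norm h"
        by (simp add: scaleR_right.sum[symmetric] scaleR_diff_right[symmetric] mult.commute)
    qed
  qed auto
  then obtain h where h: "\<And>u. u \<in> {a..b} \<Longrightarrow> (\<lambda>n. f n u) sums h u"
     "\<And>u. u \<in> {a..b} \<Longrightarrow> (h has_derivative (\<lambda>s. s *\<^sub>R g' u)) (at u within {a..b})"
    by blast
  have "(h has_vector_derivative g' x) (at x)"
    using h(2)[of x] x by (simp add: has_vector_derivative_def at_within_Icc_at)
  \<comment> \<open>The sum \<open>h\<close> is only known on [a,b]; there it equals
    \<open>g\<close> by uniqueness of limits, and x has an open neighbourhood in that
    interval.\<close>
  then show ?thesis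
    by (rule has_vector_derivative_transform_within_open[OF _ open_greaterThanLessThan x])
       (use sums_unique2[OF h(1) sums] in auto)
qed

lemma series_has_partial:
  assumes a: "geometric_on_boxes a" and a': "geometric_on_boxes a'"
    and d: "\<And>n. has_partial d (a n) (a' n)"
  shows "has_partial d (series a) (series a')"
proof -
  have *: "has_partial d (series a) (series a') \<longleftrightarrow> (\<forall>x y t. case d of
      Xi \<Rightarrow> ((\<lambda>s. series a s y t) has_vector_derivative series a' x y t) (at x)
    | Eta \<Rightarrow> ((\<lambda>s. series a x s t) has_vector_derivative series a' x y t) (at y)
    | Tm \<Rightarrow> ((\<lambda>s. series a x y s) has_vector_derivative series a' x y t) (at t))"
    by (simp add: has_partial_def)
  have "case d of
      Xi \<Rightarrow> ((\<lambda>s. series a s y t) has_vector_derivative series a' x y t) (at x)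
    | Eta \<Rightarrow> ((\<lambda>s. series a x s t) has_vector_derivative series a' x y t) (at y)
    | Tm \<Rightarrow> ((\<lambda>s. series a x y s) has_vector_derivative series a' x y t) (at t)" for x y t
  proof -
    obtain R where R: "in_box R x y t" by (rule in_box_exhaust)
    \<comment> \<open>Again the box is enlarged by 1, so that the segment through the point along
      the chosen coordinate contains the point in its interior.\<close>
    note u = uniform_limit_series[OF a', of "R + 1"]
    note s = geometric_on_boxes_sums[OF a]
    show ?thesis
    proof (cases d)
      case Xi
      have "((\<lambda>s. series a s y t) has_vector_derivative series a' x y t) (at x)"
      proof (rule has_vector_derivative_series[where f'="\<lambda>n s. a' n s y t" and a="-R-1" and b="R+1"])
        show "uniform_limit {-R-1..R+1} (\<lambda>n u. \<Sum>i<n. a' i u y t) (\<lambda>s. series a' s y t) sequentially"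
          using uniform_limit_compose'[OF u, of "\<lambda>s. (s, y, t)" "{-R-1..R+1}"] R by (auto simp: in_box_def)
      qed (use d Xi s R in \<open>auto simp: has_partial_def in_box_def\<close>)
      then show ?thesis using Xi by simp
    next
      case Eta
      have "((\<lambda>s. series a x s t) has_vector_derivative series a' x y t) (at y)"
      proof (rule has_vector_derivative_series[where f'="\<lambda>n s. a' n x s t" and a="-R-1" and b="R+1"])
        show "uniform_limit {-R-1..R+1} (\<lambda>n u. \<Sum>i<n. a' i x u t) (\<lambda>s. series a' x s t) sequentially"
          using uniform_limit_compose'[OF u, of "\<lambda>s. (x, s, t)" "{-R-1..R+1}"] R by (auto simp: in_box_def)
      qed (use d Eta s R in \<open>auto simp: has_partial_def in_box_def\<close>)
      then show ?thesis using Eta by simp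
    next
      case Tm
      have "((\<lambda>s. series a x y s) has_vector_derivative series a' x y t) (at t)"
      proof (rule has_vector_derivative_series[where f'="\<lambda>n s. a' n x y s" and a="-R-1" and b="R+1"])
        show "uniform_limit {-R-1..R+1} (\<lambda>n u. \<Sum>i<n. a' i x y u) (\<lambda>s. series a' x y s) sequentially"
          using uniform_limit_compose'[OF u, of "\<lambda>s. (x, y, s)" "{-R-1..R+1}"] R by (auto simp: in_box_def)
      qed (use d Tm s R in \<open>auto simp: has_partial_def in_box_def\<close>)
      then show ?thesis using Tm by simp
    qed
  qed
  then show ?thesis using * by blast
qed

lemma series_mult:
  assumes "geometric_on_boxes a"
  shows "series (\<lambda>n x y t. F x y t * a n x y t) x y t = F x y t * series a x y t"
  using sums_unique[OF sums_mult[OF geometric_on_boxes_sums[OF assms]], of "F x y t" x y t]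
  by (simp add: series_def)

lemma series_add:
  assumes "geometric_on_boxes a" "geometric_on_boxes b"
  shows "series (\<lambda>n x y t. a n x y t + b n x y t) x y t = series a x y t + series b x y t"
  using sums_unique[OF sums_add[OF geometric_on_boxes_sums[OF assms(1)]
      geometric_on_boxes_sums[OF assms(2)]], of x y t x y t]
  by (simp add: series_def)

lemma series_split_first:
  assumes "geometric_on_boxes a"
  shows "series a x y t = a 0 x y t + series (\<lambda>n. a (Suc n)) x y t"
  using suminf_split_head[OF sums_summable[OF geometric_on_boxes_sums[OF assms]]]
  unfolding series_def by simp

text \<open>Obtained from termwise differentiation.\<close>
lemma series_int_xi:
  assumes "geometric_on_boxes a" "geometric_on_boxes (\<lambda>n. int_xi c (a n))" "\<And>n. cont3 (a n)"
  shows "series (\<lambda>n. int_xi c (a n)) = int_xi c (series a)"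
proof (intro ext)
  fix x y t
  have "has_partial Xi (series (\<lambda>n. int_xi c (a n))) (series a)"
    using assms by (intro series_has_partial int_xi_has_partial_Xi)
  note int_xi_fundamental[OF this, of x y t c]
  moreover have "series (\<lambda>n. int_xi c (a n)) c y t = 0"
    by (simp add: series_def)
  ultimately show "series (\<lambda>n. int_xi c (a n)) x y t = int_xi c (series a) x y t"
    by simp
qed

lemma series_swap: "series (\<lambda>n. swap (a n)) = swap (series a)"
  by (simp add: series_def swap_def)

lemma series_int_eta:
  assumes "geometric_on_boxes a" "geometric_on_boxes (\<lambda>n. int_eta c (a n))" "\<And>n. cont3 (a n)"
  shows "series (\<lambda>n. int_eta c (a n)) = int_eta c (series a)"
proof -
  have "geometric_on_boxes (\<lambda>n. int_xi c (swap (a n)))"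
    using geometric_on_boxes_swap[OF assms(2)] by (simp add: int_eta_def)
  then show ?thesis
    unfolding int_eta_def series_swap
    using series_int_xi[OF geometric_on_boxes_swap[OF assms(1)] _ cont3_swap[OF assms(3)]]
    by (simp add: series_swap)
qed

subsection \<open>The Goursat problem\<close>

lemma int_eta_cont3: "cont3 F \<Longrightarrow> cont3 (int_eta c F)"
  by (simp add: int_eta_def int_xi_cont3 cont3_swap)

lemma int_eta_base [simp]: "int_eta c F x c t = 0"
  by (simp add: int_eta_def swap_def)

lemma int_eta_class_C: "class_C k F \<Longrightarrow> class_C k (int_eta c F)"
  by (simp add: int_eta_def int_xi_class_C class_C_swap)

lemma int_eta_has_partial_Eta: "cont3 F \<Longrightarrow> has_partial Eta (int_eta c F) F"
  using has_partial_swap[OF int_xi_has_partial_Xi[OF cont3_swap]]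
  by (simp add: int_eta_def)

lemma int_eta_has_partial_param:
  assumes "cont3 F" "cont3 G" "has_partial d F G" "d \<noteq> Eta"
  shows "has_partial d (int_eta c F) (int_eta c G)"
proof -
  have "swap_dir d \<noteq> Xi"
    using assms(4) by (cases d) auto
  then show ?thesis
    using has_partial_swap[OF int_xi_has_partial_param[OF assms(1,2)[THEN cont3_swap]
          has_partial_swap[OF assms(3)]], of c]
    by (simp add: int_eta_def)
qed

lemma int_eta_diff:
  assumes "cont3 F" "cont3 G"
  shows "int_eta c (\<lambda>x y t. F x y t - G x y t) x y t = int_eta c F x y t - int_eta c G x y t"
  using int_xi_diff[OF assms[THEN cont3_swap], of c y x t]
  by (simp add: int_eta_def swap_def)

lemma int_eta_add:
  assumes "cont3 F" "cont3 G"
  shows "int_eta c (\<lambda>x y t. F x y t + G x y t) x y t = int_eta c F x y t + int_eta c G x y t"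
  using int_xi_add[OF assms[THEN cont3_swap], of c y x t]
  by (simp add: int_eta_def swap_def)

lemma int_xi_zero: "int_xi c (\<lambda>x y t. 0) = (\<lambda>x y t. 0)"
  by (simp add: int_xi_def)

lemma int_eta_zero: "int_eta c (\<lambda>x y t. 0) = (\<lambda>x y t. 0)"
  by (simp add: int_eta_def swap_def int_xi_zero)

section \<open>Exponentially weighted sup norms of Bielecki type\<close>

definition exp_bounded :: "real \<Rightarrow> real \<Rightarrow> real \<Rightarrow> real \<Rightarrow> real \<Rightarrow> fn3 \<Rightarrow> bool" where
  "exp_bounded R l c d K F \<longleftrightarrow>
     (\<forall>x y t. in_box R x y t \<longrightarrow> norm (F x y t) \<le> K * exp (l * (\<bar>x - c\<bar> + \<bar>y - d\<bar>)))"

lemma exp_bounded_swap: "exp_bounded R l c d K F \<Longrightarrow> exp_bounded R l d c K (swap F)"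
  unfolding exp_bounded_def swap_def in_box_def by (metis add.commute)

lemma exp_bounded_mono: "\<lbrakk>exp_bounded R l c d K F; K \<le> L\<rbrakk> \<Longrightarrow> exp_bounded R l c d L F"
  unfolding exp_bounded_def by (meson exp_ge_zero mult_right_mono order_trans)

lemma exp_bounded_add:
  assumes "exp_bounded R l c d K F" "exp_bounded R l c d L G"
  shows "exp_bounded R l c d (K + L) (\<lambda>x y t. F x y t + G x y t)"
  using assms unfolding exp_bounded_def distrib_right by (meson norm_triangle_mono)

lemma exp_bounded_mult:
  assumes "\<And>x y t. in_box R x y t \<Longrightarrow> norm (q x y t) \<le> M" "exp_bounded R l c d K F" "M \<ge> 0"
  shows "exp_bounded R l c d (M * K) (\<lambda>x y t. q x y t * F x y t)"
  unfolding exp_bounded_def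
proof (intro allI impI)
  fix x y t
  assume b: "in_box R x y t"
  have "norm (F x y t) \<le> K * exp (l * (\<bar>x - c\<bar> + \<bar>y - d\<bar>))"
    using assms(2) b by (simp add: exp_bounded_def)
  then show "norm (q x y t * F x y t) \<le> M * K * exp (l * (\<bar>x - c\<bar> + \<bar>y - d\<bar>))"
    unfolding norm_mult mult.assoc by (intro mult_mono assms b norm_ge_zero)
qed

text \<open>The part exp (l |y - d|) of the weight is constant along the integration and joins the
  constant \<open>K\<close>; the part in x gains 1/l. With |c| at most R the segment of integration
  stays in the box.\<close>

lemma exp_bounded_int_xi:
  assumes F: "cont3 F" "exp_bounded R l c d K F" and l: "l > 0" and K: "K \<ge> 0" and c: "\<bar>c\<bar> \<le> R"
  shows "exp_bounded R l c d (K / l) (int_xi c F)"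
  unfolding exp_bounded_def
proof (intro allI impI)
  fix x y t
  assume b: "in_box R x y t"
  have "norm (int_xi c F x y t) \<le> K * exp (l * \<bar>y - d\<bar>) / l * exp (l * \<bar>x - c\<bar>)"
  proof (rule int_xi_exp_bound[OF F(1) l])
    fix s :: real
    assume s: "s \<in> {0..1}"
    have "c + s * (x - c) \<in> {-R..R}"
      by (rule segment_in_interval[OF _ _ s]) (use b c in \<open>auto simp: in_box_def\<close>)
    then have "in_box R (c + s * (x - c)) y t"
      using b by (simp add: in_box_def)
    then have "norm (F (c + s * (x - c)) y t) \<le> K * exp (l * (\<bar>c + s * (x - c) - c\<bar> + \<bar>y - d\<bar>))"
      using F(2) unfolding exp_bounded_def by blast
    then show "norm (F (c + s * (x - c)) y t)
        \<le> K * exp (l * \<bar>y - d\<bar>) * exp (l * \<bar>c + s * (x - c) - c\<bar>)"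
      by (simp add: distrib_left exp_add mult_ac)
  qed (use K in auto)
  then show "norm (int_xi c F x y t) \<le> K / l * exp (l * (\<bar>x - c\<bar> + \<bar>y - d\<bar>))"
    by (simp add: distrib_left exp_add mult_ac)
qed

lemma exp_bounded_int_eta:
  assumes "cont3 F" "exp_bounded R l c d K F" "l > 0" "K \<ge> 0" "\<bar>d\<bar> \<le> R"
  shows "exp_bounded R l c d (K / l) (int_eta d F)"
  using exp_bounded_swap[OF exp_bounded_int_xi[OF cont3_swap exp_bounded_swap]] assms
  by (simp add: int_eta_def)

lemma cont3_exp_bounded:
  assumes "cont3 F" "l \<ge> 0"
  obtains K where "K \<ge> 0" "exp_bounded R l c d K F"
proof -
  obtain B where B: "B \<ge> 0" "\<And>x y t. in_box R x y t \<Longrightarrow> norm (F x y t) \<le> B"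
    using cont3_bounded_on_box[OF assms(1)] by metis
  \<comment> \<open>The weight is at least 1, so an unweighted bound is also a weighted one.\<close>
  have "B \<le> B * exp (l * (\<bar>x - c\<bar> + \<bar>y - d\<bar>))" for x y
    using B(1) assms(2) by (intro mult_le_cancel_left1[THEN iffD2]) auto
  then have "exp_bounded R l c d B F"
    unfolding exp_bounded_def using B(2) order_trans by blast
  with B(1) show thesis by (rule that)
qed

text \<open>On the box |x - c| + |y - d| is at most 2R + |c| + |d|, so the weight can be replaced by
  a constant independent of n.\<close>

lemma exp_bounded_geometric:
  assumes "\<And>n. exp_bounded R l c d (K * (1/2) ^ n) (a n)" "l \<ge> 0" "S \<le> R" "K \<ge> 0" "in_box S x y t"
  shows "norm (a n x y t) \<le> K * exp (l * (2 * R + \<bar>c\<bar> + \<bar>d\<bar>)) * (1/2) ^ n"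
proof -
  have b: "in_box R x y t"
    using assms in_box_mono by blast
  then have "norm (a n x y t) \<le> K * (1/2) ^ n * exp (l * (\<bar>x - c\<bar> + \<bar>y - d\<bar>))"
    using assms(1) by (simp add: exp_bounded_def)
  also have "\<dots> \<le> K * (1/2) ^ n * exp (l * (2 * R + \<bar>c\<bar> + \<bar>d\<bar>))"
    using b assms(2,4) by (intro mult_left_mono exp_le_cancel_iff[THEN iffD2]) (auto simp: in_box_def)
  finally show ?thesis by (simp add: mult_ac)
qed

text \<open>The weight \<open>exp (l * (\<bar>x - c\<bar> + \<bar>y - d\<bar>))\<close> with \<open>l\<close> four times a bound for the coefficients makes
  one integration gain a factor \<open>1/4\<close>; the two summands of the differentiated recurrence
  then still leave a factor \<open>1/2\<close>.\<close>
lemma goursat_iterates_geometric: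
  assumes cont: "cont3 q1" "cont3 q2" "cont3 p1" "cont3 p2"
      "\<And>n. cont3 (a n)" "\<And>n. cont3 (b n)" "\<And>n. cont3 (a' n)" "\<And>n. cont3 (b' n)"
    and a: "\<And>n. a (Suc n) = int_xi c (\<lambda>x y t. q1 x y t * b n x y t)"
    and b: "\<And>n. b (Suc n) = int_eta d (\<lambda>x y t. q2 x y t * a n x y t)"
    and a': "\<And>n. a' (Suc n) = int_xi c (\<lambda>x y t. p1 x y t * b n x y t + q1 x y t * b' n x y t)"
    and b': "\<And>n. b' (Suc n) = int_eta d (\<lambda>x y t. p2 x y t * a n x y t + q2 x y t * a' n x y t)"
  shows "geometric_on_boxes a" "geometric_on_boxes b" "geometric_on_boxes a'" "geometric_on_boxes b'"
proof -
  have "\<exists>L. \<forall>n x y t. in_box S x y t \<longrightarrow>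
      norm (a n x y t) \<le> L * (1/2) ^ n \<and> norm (b n x y t) \<le> L * (1/2) ^ n \<and>
      norm (a' n x y t) \<le> L * (1/2) ^ n \<and> norm (b' n x y t) \<le> L * (1/2) ^ n" for S
  proof -
    \<comment> \<open>The box is enlarged to contain the base points \<open>c\<close> and
      \<open>d\<close>, since the integrals start there.\<close>
    define R where "R = max S (max \<bar>c\<bar> \<bar>d\<bar>)"
    have R: "\<bar>c\<bar> \<le> R" "\<bar>d\<bar> \<le> R" "S \<le> R"
      by (auto simp: R_def)
    obtain M1 where M1: "M1 \<ge> 0" "\<And>x y t. in_box R x y t \<Longrightarrow> norm (q1 x y t) \<le> M1"
      using cont3_bounded_on_box[OF cont(1)] by metis
    obtain M2 where M2: "M2 \<ge> 0" "\<And>x y t. in_box R x y t \<Longrightarrow> norm (q2 x y t) \<le> M2"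
      using cont3_bounded_on_box[OF cont(2)] by metis
    obtain M3 where M3: "M3 \<ge> 0" "\<And>x y t. in_box R x y t \<Longrightarrow> norm (p1 x y t) \<le> M3"
      using cont3_bounded_on_box[OF cont(3)] by metis
    obtain M4 where M4: "M4 \<ge> 0" "\<And>x y t. in_box R x y t \<Longrightarrow> norm (p2 x y t) \<le> M4"
      using cont3_bounded_on_box[OF cont(4)] by metis
    \<comment> \<open>The summand 1 keeps \<open>M\<close>, hence also the exponent
      \<open>l\<close>, strictly positive even for vanishing coefficients.\<close>
    define M where "M = 1 + M1 + M2 + M3 + M4"
    have M: "M > 0" "M \<ge> 0"
      using M1(1) M2(1) M3(1) M4(1) by (auto simp: M_def)
    have le: "M1 \<le> M" "M2 \<le> M" "M3 \<le> M" "M4 \<le> M"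
      using M1(1) M2(1) M3(1) M4(1) by (auto simp: M_def)
    have q: "norm (q1 x y t) \<le> M" "norm (q2 x y t) \<le> M" "norm (p1 x y t) \<le> M" "norm (p2 x y t) \<le> M"
      if "in_box R x y t" for x y t
      using M1(2)[OF that] M2(2)[OF that] M3(2)[OF that] M4(2)[OF that] le by linarith+
    define l where "l = 4 * M"
    have l: "l > 0" "l \<ge> 0"
      using M by (auto simp: l_def)
    obtain K1 where K1: "K1 \<ge> 0" "exp_bounded R l c d K1 (a 0)"
      using cont3_exp_bounded[OF cont(5) l(2)] by metis
    obtain K2 where K2: "K2 \<ge> 0" "exp_bounded R l c d K2 (b 0)"
      using cont3_exp_bounded[OF cont(6) l(2)] by metis
    obtain K3 where K3: "K3 \<ge> 0" "exp_bounded R l c d K3 (a' 0)"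
      using cont3_exp_bounded[OF cont(7) l(2)] by metis
    obtain K4 where K4: "K4 \<ge> 0" "exp_bounded R l c d K4 (b' 0)"
      using cont3_exp_bounded[OF cont(8) l(2)] by metis
    define K where "K = K1 + K2 + K3 + K4"
    have K: "K \<ge> 0" "K1 \<le> K" "K2 \<le> K" "K3 \<le> K" "K4 \<le> K"
      using K1(1) K2(1) K3(1) K4(1) by (auto simp: K_def)
    have *: "exp_bounded R l c d (K * (1/2) ^ n) (a n) \<and> exp_bounded R l c d (K * (1/2) ^ n) (b n) \<and>
          exp_bounded R l c d (K * (1/2) ^ n) (a' n) \<and> exp_bounded R l c d (K * (1/2) ^ n) (b' n)" for n
    proof (induction n)
      case 0
      show ?case
        using K1(2) K2(2) K3(2) K4(2) K by (auto intro: exp_bounded_mono)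
    next
      case (Suc n)
      let ?E = "exp_bounded R l c d"
      let ?k = "K * (1/2) ^ n"
      have k: "?k \<ge> 0"
        using K by simp
      have s1: "?E (M * ?k) (\<lambda>x y t. q1 x y t * b n x y t)"
        and s2: "?E (M * ?k) (\<lambda>x y t. q2 x y t * a n x y t)"
        and s3: "?E (M * ?k + M * ?k) (\<lambda>x y t. p1 x y t * b n x y t + q1 x y t * b' n x y t)"
        and s4: "?E (M * ?k + M * ?k) (\<lambda>x y t. p2 x y t * a n x y t + q2 x y t * a' n x y t)"
        by (intro exp_bounded_add exp_bounded_mult q M; use Suc.IH in simp)+
      have e1: "M * ?k / l \<le> K * (1/2) ^ Suc n" and e2: "(M * ?k + M * ?k) / l \<le> K * (1/2) ^ Suc n"
        and nn: "M * ?k \<ge> 0" "M * ?k + M * ?k \<ge> 0"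
        using M K by (auto simp: l_def field_simps)
      have "?E (K * (1/2) ^ Suc n) (a (Suc n))"
        unfolding a by (rule exp_bounded_mono[OF exp_bounded_int_xi[OF _ s1 l(1) nn(1) R(1)] e1])
           (intro cont3_intros cont)
      moreover have "?E (K * (1/2) ^ Suc n) (b (Suc n))"
        unfolding b by (rule exp_bounded_mono[OF exp_bounded_int_eta[OF _ s2 l(1) nn(1) R(2)] e1])
           (intro cont3_intros cont)
      moreover have "?E (K * (1/2) ^ Suc n) (a' (Suc n))"
        unfolding a' by (rule exp_bounded_mono[OF exp_bounded_int_xi[OF _ s3 l(1) nn(2) R(1)] e2])
           (intro cont3_intros cont)
      moreover have "?E (K * (1/2) ^ Suc n) (b' (Suc n))"
        unfolding b' by (rule exp_bounded_mono[OF exp_bounded_int_eta[OF _ s4 l(1) nn(2) R(2)] e2])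
           (intro cont3_intros cont)
      ultimately show ?case by blast
    qed
    show ?thesis
      by (rule exI[where x="K * exp (l * (2 * R + \<bar>c\<bar> + \<bar>d\<bar>))"], intro allI impI conjI;
          rule exp_bounded_geometric[OF _ l(2) R(3) K(1)]) (use * in auto)
  qed
  then show "geometric_on_boxes a" "geometric_on_boxes b" "geometric_on_boxes a'" "geometric_on_boxes b'"
    unfolding geometric_on_boxes_def by meson+
qed

text \<open>The undifferentiated recurrence is the case in which \<open>p1\<close>,
  \<open>p2\<close> and the sequences \<open>a'\<close>, \<open>b'\<close> are all zero.\<close>

corollary goursat_iterates_geometric':
  assumes cont: "cont3 q1" "cont3 q2" "\<And>n. cont3 (a n)" "\<And>n. cont3 (b n)"
    and a: "\<And>n. a (Suc n) = int_xi c (\<lambda>x y t. q1 x y t * b n x y t)"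
    and b: "\<And>n. b (Suc n) = int_eta d (\<lambda>x y t. q2 x y t * a n x y t)"
  shows "geometric_on_boxes a" "geometric_on_boxes b"
  using goursat_iterates_geometric(1,2)[where a' = "\<lambda>n x y t. 0" and b' = "\<lambda>n x y t. 0"
      and ?p1.0 = "\<lambda>x y t. 0" and ?p2.0 = "\<lambda>x y t. 0" and a = a and b = b, OF cont(1,2) _ _ cont(3,4) _ _ a b]
  by (simp_all add: int_xi_zero int_eta_zero cont3_const)

section \<open>Existence, uniqueness and regularity of solutions of the integral equations\<close>

definition goursat_solution ::
    "real \<Rightarrow> real \<Rightarrow> fn3 \<Rightarrow> fn3 \<Rightarrow> fn3 \<Rightarrow> fn3 \<Rightarrow> fn3 \<Rightarrow> fn3 \<Rightarrow> bool" where
  "goursat_solution c d q1 q2 f h \<psi> \<phi> \<longleftrightarrow> cont3 \<psi> \<and> cont3 \<phi> \<and>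
     (\<forall>x y t. \<psi> x y t = f x y t + int_xi c (\<lambda>x y t. q1 x y t * \<phi> x y t) x y t) \<and>
     (\<forall>x y t. \<phi> x y t = h x y t + int_eta d (\<lambda>x y t. q2 x y t * \<psi> x y t) x y t)"

lemma goursat_solutionD:
  assumes "goursat_solution c d q1 q2 f h \<psi> \<phi>"
  shows "cont3 \<psi>" "cont3 \<phi>"
    "\<psi> = (\<lambda>x y t. f x y t + int_xi c (\<lambda>x y t. q1 x y t * \<phi> x y t) x y t)"
    "\<phi> = (\<lambda>x y t. h x y t + int_eta d (\<lambda>x y t. q2 x y t * \<psi> x y t) x y t)"
  using assms unfolding goursat_solution_def by blast+

text \<open>By linearity the difference of two solutions solves the homogeneous problem. Uniqueness
  identifies any given solution with the series of iterates, which can be differentiated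
  termwise.\<close>

lemma goursat_solution_unique:
  assumes q: "cont3 q1" "cont3 q2"
    and s: "goursat_solution c d q1 q2 f h \<psi> \<phi>" "goursat_solution c d q1 q2 f h \<psi>' \<phi>'"
  shows "\<psi> = \<psi>'" "\<phi> = \<phi>'"
proof -
  define u where "u = (\<lambda>x y t. \<psi> x y t - \<psi>' x y t)"
  define v where "v = (\<lambda>x y t. \<phi> x y t - \<phi>' x y t)"
  have c: "cont3 \<psi>" "cont3 \<phi>" "cont3 \<psi>'" "cont3 \<phi>'"
    using s by (blast dest: goursat_solutionD)+
  have uv: "cont3 u" "cont3 v"
    unfolding u_def v_def by (intro cont3_intros c)+
  have "u = int_xi c (\<lambda>x y t. q1 x y t * v x y t)"
  proof (intro ext)
    fix x y t
    have "u x y t = int_xi c (\<lambda>x y t. q1 x y t * \<phi> x y t) x y t - int_xi c (\<lambda>x y t. q1 x y t * \<phi>' x y t) x y t"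
      unfolding u_def by (subst s[THEN goursat_solutionD(3)])+ simp
    also have "\<dots> = int_xi c (\<lambda>x y t. q1 x y t * \<phi> x y t - q1 x y t * \<phi>' x y t) x y t"
      by (rule int_xi_diff[symmetric]; intro cont3_intros q c)
    finally show "u x y t = int_xi c (\<lambda>x y t. q1 x y t * v x y t) x y t"
      by (simp add: v_def right_diff_distrib)
  qed
  moreover have "v = int_eta d (\<lambda>x y t. q2 x y t * u x y t)"
  proof (intro ext)
    fix x y t
    have "v x y t = int_eta d (\<lambda>x y t. q2 x y t * \<psi> x y t) x y t - int_eta d (\<lambda>x y t. q2 x y t * \<psi>' x y t) x y t"
      unfolding v_def by (subst s[THEN goursat_solutionD(4)])+ simp
    also have "\<dots> = int_eta d (\<lambda>x y t. q2 x y t * \<psi> x y t - q2 x y t * \<psi>' x y t) x y t"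
      by (rule int_eta_diff[symmetric]; intro cont3_intros q c)
    finally show "v x y t = int_eta d (\<lambda>x y t. q2 x y t * u x y t) x y t"
      by (simp add: u_def right_diff_distrib)
  qed
  \<comment> \<open>The constant sequences \<open>u\<close>, \<open>v\<close> are iterates of the homogeneous problem, hence decay.\<close>
  ultimately have "geometric_on_boxes (\<lambda>n. u)" "geometric_on_boxes (\<lambda>n. v)"
    using goursat_iterates_geometric'[OF q, of "\<lambda>n. u" "\<lambda>n. v" c d] uv by blast+
  then have "u x y t = 0" "v x y t = 0" for x y t
    by (auto intro: geometric_on_boxes_const_eq_0)
  then show "\<psi> = \<psi>'" "\<phi> = \<phi>'"
    by (auto simp: u_def v_def intro!: ext)
qed

text \<open>These are the terms of the Neumann series, that is the increments of Picard iteration,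
  so the data \<open>f\<close>, \<open>h\<close> enter only at index 0.\<close>

fun goursat_iter :: "real \<Rightarrow> real \<Rightarrow> fn3 \<Rightarrow> fn3 \<Rightarrow> fn3 \<Rightarrow> fn3 \<Rightarrow> nat \<Rightarrow> fn3 \<times> fn3" where
  "goursat_iter c d q1 q2 f h 0 = (f, h)"
| "goursat_iter c d q1 q2 f h (Suc n) =
     (int_xi c (\<lambda>x y t. q1 x y t * snd (goursat_iter c d q1 q2 f h n) x y t),
      int_eta d (\<lambda>x y t. q2 x y t * fst (goursat_iter c d q1 q2 f h n) x y t))"

lemma goursat_iter_cont3:
  assumes "cont3 q1" "cont3 q2" "cont3 f" "cont3 h"
  shows "cont3 (fst (goursat_iter c d q1 q2 f h n)) \<and> cont3 (snd (goursat_iter c d q1 q2 f h n))"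
  by (induction n) (auto intro!: assms int_xi_cont3 int_eta_cont3 cont3_mult)

text \<open>Splitting off the term of index 0 leaves the data; in the remaining series sum and
  integral are interchanged, which gives back the integral of the full series.\<close>

lemma goursat_series_solution:
  fixes c d :: real
  assumes q: "cont3 q1" "cont3 q2" and fh: "cont3 f" "cont3 h"
  defines "a \<equiv> \<lambda>n. fst (goursat_iter c d q1 q2 f h n)"
    and "b \<equiv> \<lambda>n. snd (goursat_iter c d q1 q2 f h n)"
  shows "goursat_solution c d q1 q2 f h (series a) (series b)"
proof -
  have ca: "cont3 (a n)" and cb: "cont3 (b n)" for n
    using goursat_iter_cont3[OF q fh] by (auto simp: a_def b_def)
  have a: "a (Suc n) = int_xi c (\<lambda>x y t. q1 x y t * b n x y t)"
    and b: "b (Suc n) = int_eta d (\<lambda>x y t. q2 x y t * a n x y t)" for n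
    by (simp_all add: a_def b_def)
  note g = goursat_iterates_geometric'[of q1 q2 a b, OF q ca cb a b]
  note ga = g(1)[THEN geometric_on_boxes_Suc] and gb = g(2)[THEN geometric_on_boxes_Suc]
  have "series (\<lambda>n. a (Suc n)) = int_xi c (series (\<lambda>n x y t. q1 x y t * b n x y t))"
    using ga unfolding a
    by (intro series_int_xi geometric_on_boxes_mult g q cont3_mult cb)
  moreover have "series (\<lambda>n. b (Suc n)) = int_eta d (series (\<lambda>n x y t. q2 x y t * a n x y t))"
    using gb unfolding b
    by (intro series_int_eta geometric_on_boxes_mult g q cont3_mult ca)
  moreover have "a 0 = f" "b 0 = h"
    by (simp_all add: a_def b_def)
  ultimately show ?thesis
    unfolding goursat_solution_def
    using series_cont3[OF g(1) ca] series_cont3[OF g(2) cb]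
      series_split_first[OF g(1)] series_split_first[OF g(2)]
    by (simp add: series_mult[OF g(1), abs_def] series_mult[OF g(2), abs_def])
qed

text \<open>The iterates are differentiated termwise in t. Differentiating \<open>q1\<close> and
  \<open>q2\<close> adds integrals of the known \<phi> and \<psi> to the data, and these depend on
  all three variables; hence \<open>goursat_solution\<close> admits arbitrary \<open>f\<close> and
  \<open>h\<close>.\<close>

lemma goursat_solution_time_derivative:
  assumes q: "cont3 q1" "cont3 q2" and fh: "cont3 f" "cont3 h"
    and p: "cont3 p1" "cont3 p2" "has_partial Tm q1 p1" "has_partial Tm q2 p2"
    and fh': "cont3 f'" "cont3 h'" "has_partial Tm f f'" "has_partial Tm h h'"
    and sol: "goursat_solution c d q1 q2 f h \<psi> \<phi>"
  obtains \<psi>' \<phi>' where "has_partial Tm \<psi> \<psi>'" "has_partial Tm \<phi> \<phi>'"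
    "goursat_solution c d q1 q2
       (\<lambda>x y t. f' x y t + int_xi c (\<lambda>x y t. p1 x y t * \<phi> x y t) x y t)
       (\<lambda>x y t. h' x y t + int_eta d (\<lambda>x y t. p2 x y t * \<psi> x y t) x y t) \<psi>' \<phi>'"
proof -
  define a where "a = (\<lambda>n. fst (goursat_iter c d q1 q2 f h n))"
  define b where "b = (\<lambda>n. snd (goursat_iter c d q1 q2 f h n))"
  have ca: "cont3 (a n)" and cb: "cont3 (b n)" for n
    using goursat_iter_cont3[OF q fh] by (auto simp: a_def b_def)
  have a: "a (Suc n) = int_xi c (\<lambda>x y t. q1 x y t * b n x y t)"
    and b: "b (Suc n) = int_eta d (\<lambda>x y t. q2 x y t * a n x y t)" for n
    by (simp_all add: a_def b_def)
  have eq: "\<psi> = series a" "\<phi> = series b"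
    using goursat_solution_unique[OF q sol goursat_series_solution[OF q fh]]
    by (simp_all add: a_def b_def)
  \<comment> \<open>This is the recurrence of the iterates differentiated in t by the product rule,
    with \<open>p1\<close>, \<open>p2\<close> the time derivatives of the coefficients.\<close>
  define D where "D = rec_nat (f', h') (\<lambda>n ab.
      (int_xi c (\<lambda>x y t. p1 x y t * b n x y t + q1 x y t * snd ab x y t),
       int_eta d (\<lambda>x y t. p2 x y t * a n x y t + q2 x y t * fst ab x y t)))"
  define a' where "a' = (\<lambda>n. fst (D n))"
  define b' where "b' = (\<lambda>n. snd (D n))"
  have a': "a' (Suc n) = int_xi c (\<lambda>x y t. p1 x y t * b n x y t + q1 x y t * b' n x y t)"
    and b': "b' (Suc n) = int_eta d (\<lambda>x y t. p2 x y t * a n x y t + q2 x y t * a' n x y t)" for n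
    by (simp_all add: a'_def b'_def D_def)
  have zero: "a 0 = f" "b 0 = h" "a' 0 = f'" "b' 0 = h'"
    by (simp_all add: a_def b_def a'_def b'_def D_def)
  have cab': "cont3 (a' n) \<and> cont3 (b' n)" for n
    by (induction n)
      (auto simp: zero a' b' intro!: fh' q p ca cb int_xi_cont3 int_eta_cont3 cont3_mult cont3_add)
  then have ca': "cont3 (a' n)" and cb': "cont3 (b' n)" for n
    by auto
  have D: "has_partial Tm (a n) (a' n) \<and> has_partial Tm (b n) (b' n)" for n
  proof (induction n)
    case (Suc n)
    then show ?case
      unfolding a b a' b'
      by (intro conjI int_xi_has_partial_param int_eta_has_partial_param has_partial_mult p
          cont3_intros q ca cb ca' cb') auto
  qed (simp add: zero fh')
  note g = goursat_iterates_geometric[of q1 q2 p1 p2 a b a' b', OF q p(1,2) ca cb ca' cb' a b a' b']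
  note ga = g(3)[THEN geometric_on_boxes_Suc] and gb = g(4)[THEN geometric_on_boxes_Suc]
  have da: "has_partial Tm \<psi> (series a')" "has_partial Tm \<phi> (series b')"
    unfolding eq using D by (auto intro!: series_has_partial g)
  have i1: "series (\<lambda>n. a' (Suc n)) =
      int_xi c (series (\<lambda>n x y t. p1 x y t * b n x y t + q1 x y t * b' n x y t))"
    using ga unfolding a'
    by (intro series_int_xi geometric_on_boxes_mult geometric_on_boxes_add g q p cont3_intros cb cb')
  have i2: "series (\<lambda>n. b' (Suc n)) =
      int_eta d (series (\<lambda>n x y t. p2 x y t * a n x y t + q2 x y t * a' n x y t))"
    using gb unfolding b'
    by (intro series_int_eta geometric_on_boxes_mult geometric_on_boxes_add g q p cont3_intros ca ca')
  have m1: "series (\<lambda>n x y t. p1 x y t * b n x y t + q1 x y t * b' n x y t) =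
      (\<lambda>x y t. p1 x y t * \<phi> x y t + q1 x y t * series b' x y t)"
    by (intro ext) (simp add: eq series_add geometric_on_boxes_mult series_mult g q p)
  have m2: "series (\<lambda>n x y t. p2 x y t * a n x y t + q2 x y t * a' n x y t) =
      (\<lambda>x y t. p2 x y t * \<psi> x y t + q2 x y t * series a' x y t)"
    by (intro ext) (simp add: eq series_add geometric_on_boxes_mult series_mult g q p)
  have c: "cont3 \<psi>" "cont3 \<phi>" "cont3 (series a')" "cont3 (series b')"
    using goursat_solutionD(1,2)[OF sol] series_cont3[OF g(3) ca'] series_cont3[OF g(4) cb'] by auto
  have "goursat_solution c d q1 q2
       (\<lambda>x y t. f' x y t + int_xi c (\<lambda>x y t. p1 x y t * \<phi> x y t) x y t)
       (\<lambda>x y t. h' x y t + int_eta d (\<lambda>x y t. p2 x y t * \<psi> x y t) x y t) (series a') (series b')"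
    unfolding goursat_solution_def
  proof (intro conjI c allI)
    fix x y t
    show "series a' x y t = f' x y t + int_xi c (\<lambda>x y t. p1 x y t * \<phi> x y t) x y t
        + int_xi c (\<lambda>x y t. q1 x y t * series b' x y t) x y t"
      using int_xi_add[of "\<lambda>x y t. p1 x y t * \<phi> x y t" "\<lambda>x y t. q1 x y t * series b' x y t" c x y t]
      by (simp add: series_split_first[OF g(3)] i1 m1 zero cont3_mult p q c)
    show "series b' x y t = h' x y t + int_eta d (\<lambda>x y t. p2 x y t * \<psi> x y t) x y t
        + int_eta d (\<lambda>x y t. q2 x y t * series a' x y t) x y t"
      using int_eta_add[of "\<lambda>x y t. p2 x y t * \<psi> x y t" "\<lambda>x y t. q2 x y t * series a' x y t" d x y t]
      by (simp add: series_split_first[OF g(4)] i2 m2 zero cont3_mult p q c)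
  qed
  with da show thesis by (rule that)
qed

text \<open>The induction on the order generalises over data and solution, because the time
  derivative solves a problem with other data. The coefficients are smooth of every order, so they
  lose nothing from step to step.\<close>

lemma goursat_solution_class_C:
  assumes q: "\<And>k. class_C k q1" "\<And>k. class_C k q2"
  shows "\<lbrakk>class_C k f; class_C k h; goursat_solution c d q1 q2 f h \<psi> \<phi>\<rbrakk> \<Longrightarrow> class_C k \<psi> \<and> class_C k \<phi>"
proof (induction k arbitrary: f h \<psi> \<phi>)
  case 0
  then show ?case using goursat_solutionD(1,2) by simp
next
  case (Suc k)
  have cq: "cont3 q1" "cont3 q2"
    using q class_C_cont3 by blast+
  note c\<psi>\<phi> = goursat_solutionD(1,2)[OF Suc.prems(3)]
    and \<psi> = goursat_solutionD(3)[OF Suc.prems(3)]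
    and \<phi> = goursat_solutionD(4)[OF Suc.prems(3)]
  have k: "class_C k f" "class_C k h"
    using Suc.prems class_C_Suc by blast+
  have IH: "class_C k \<psi>" "class_C k \<phi>"
    using Suc.IH[OF k Suc.prems(3)] by auto
  have "\<exists>G H. has_partial e \<psi> G \<and> has_partial e \<phi> H \<and> class_C k G \<and> class_C k H" for e
  proof -
    obtain f' where f': "has_partial e f f'" "class_C k f'"
      using class_C_SucD[OF Suc.prems(1)] by blast
    obtain h' where h': "has_partial e h h'" "class_C k h'"
      using class_C_SucD[OF Suc.prems(2)] by blast
    obtain p1 where p1: "has_partial e q1 p1" "class_C k p1"
      using class_C_SucD[OF q(1)] by blast
    obtain p2 where p2: "has_partial e q2 p2" "class_C k p2"
      using class_C_SucD[OF q(2)] by blast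
    note cont = f'(2)[THEN class_C_cont3] h'(2)[THEN class_C_cont3]
      p1(2)[THEN class_C_cont3] p2(2)[THEN class_C_cont3]
    show ?thesis
    proof (cases e)
      case Xi
      \<comment> \<open>The \<xi>-derivative of \<psi> is read off its integral equation; inserting
        it under the \<eta>-integral then gives that of \<phi>. In the case of \<eta> the order is
        reversed.\<close>
      define G where "G = (\<lambda>x y t. f' x y t + q1 x y t * \<phi> x y t)"
      have G: "has_partial Xi \<psi> G" "class_C k G"
        unfolding G_def
         apply (subst \<psi>, intro has_partial_add int_xi_has_partial_Xi cont3_mult cq c\<psi>\<phi>)
        using f' Xi apply simp
        by (intro class_C_add class_C_mult f' q IH)
      define H where "H = (\<lambda>x y t. h' x y t
          + int_eta d (\<lambda>x y t. p2 x y t * \<psi> x y t + q2 x y t * G x y t) x y t)"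
      have "has_partial Xi \<phi> H" "class_C k H"
        unfolding H_def
        using h'(1) p2(1) G(1) Xi
         apply (subst \<phi>, intro has_partial_add int_eta_has_partial_param has_partial_mult
            cont3_intros cq c\<psi>\<phi> cont class_C_cont3[OF G(2)]; simp)
        by (intro class_C_add class_C_mult int_eta_class_C h' p2 q IH G)
      then show ?thesis using G Xi by blast
    next
      case Eta
      define H where "H = (\<lambda>x y t. h' x y t + q2 x y t * \<psi> x y t)"
      have H: "has_partial Eta \<phi> H" "class_C k H"
        unfolding H_def
         apply (subst \<phi>, intro has_partial_add int_eta_has_partial_Eta cont3_mult cq c\<psi>\<phi>)
        using h' Eta apply simp
        by (intro class_C_add class_C_mult h' q IH)
      define G where "G = (\<lambda>x y t. f' x y t
          + int_xi c (\<lambda>x y t. p1 x y t * \<phi> x y t + q1 x y t * H x y t) x y t)"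
      have "has_partial Eta \<psi> G" "class_C k G"
        unfolding G_def
        using f'(1) p1(1) H(1) Eta
         apply (subst \<psi>, intro has_partial_add int_xi_has_partial_param has_partial_mult
            cont3_intros cq c\<psi>\<phi> cont class_C_cont3[OF H(2)]; simp)
        by (intro class_C_add class_C_mult int_xi_class_C f' p1 q IH H)
      then show ?thesis using H Eta by blast
    next
      case Tm
      obtain \<psi>' \<phi>' where t: "has_partial Tm \<psi> \<psi>'" "has_partial Tm \<phi> \<phi>'"
        "goursat_solution c d q1 q2
           (\<lambda>x y t. f' x y t + int_xi c (\<lambda>x y t. p1 x y t * \<phi> x y t) x y t)
           (\<lambda>x y t. h' x y t + int_eta d (\<lambda>x y t. p2 x y t * \<psi> x y t) x y t) \<psi>' \<phi>'"
        using goursat_solution_time_derivative[OF cq k[THEN class_C_cont3] cont(3,4) _ _ cont(1,2)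
            _ _ Suc.prems(3)] f'(1) h'(1) p1(1) p2(1) Tm by blast
      \<comment> \<open>The data of the differentiated problem are of class C^k, because \<psi> and
        \<phi> already are by the induction hypothesis; a second use of that hypothesis treats the
        time derivatives.\<close>
      have "class_C k \<psi>' \<and> class_C k \<phi>'"
        by (rule Suc.IH[OF _ _ t(3)];
            intro class_C_add class_C_mult int_xi_class_C int_eta_class_C f' h' p1 p2 IH)
      then show ?thesis using t Tm by blast
    qed
  qed
  then show ?case
    using c\<psi>\<phi> by (meson class_C_SucI)
qed

text \<open>Constant data \<alpha>, \<beta> are prescribed. Both integrals vanish at \<xi> = c,
  \<eta> = d, so the solution takes exactly these values there.\<close>

lemma goursat_smooth_solution_through_point:
  assumes "smooth3 q1" "smooth3 q2"
  obtains \<psi> \<phi> where "smooth3 \<psi>" "smooth3 \<phi>"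
    "pxi \<psi> = (\<lambda>x y t. q1 x y t * \<phi> x y t)" "peta \<phi> = (\<lambda>x y t. q2 x y t * \<psi> x y t)"
    "\<psi> c d t = \<alpha>" "\<phi> c d t = \<beta>"
proof -
  have cq: "cont3 q1" "cont3 q2"
    using assms smooth3_cont3 by blast+
  obtain \<psi> \<phi> where sol: "goursat_solution c d q1 q2 (\<lambda>x y t. \<alpha>) (\<lambda>x y t. \<beta>) \<psi> \<phi>"
    using goursat_series_solution[OF cq cont3_const cont3_const] by blast
  note c = goursat_solutionD(1,2)[OF sol]
    and \<psi> = goursat_solutionD(3)[OF sol] and \<phi> = goursat_solutionD(4)[OF sol]
  show thesis
  proof
    show "smooth3 \<psi>" "smooth3 \<phi>"
      using goursat_solution_class_C[OF _ _ class_C_const class_C_const sol] assms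
      by (auto simp: smooth3_iff_class_C)
    have "has_partial Xi \<psi> (\<lambda>x y t. 0 + q1 x y t * \<phi> x y t)"
      by (subst \<psi>, intro has_partial_add has_partial_const int_xi_has_partial_Xi cont3_mult cq c)
    from has_partial_pdir[OF this] show "pxi \<psi> = (\<lambda>x y t. q1 x y t * \<phi> x y t)"
      by simp
    have "has_partial Eta \<phi> (\<lambda>x y t. 0 + q2 x y t * \<psi> x y t)"
      by (subst \<phi>, intro has_partial_add has_partial_const int_eta_has_partial_Eta cont3_mult cq c)
    from has_partial_pdir[OF this] show "peta \<phi> = (\<lambda>x y t. q2 x y t * \<psi> x y t)"
      by simp
    show "\<psi> c d t = \<alpha>"
      by (subst \<psi>) simp
    show "\<phi> c d t = \<beta>"
      by (subst \<phi>) simp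
  qed
qed

subsection \<open>Calculus of partial derivatives\<close>

lemma smooth3_add: "\<lbrakk>smooth3 F; smooth3 G\<rbrakk> \<Longrightarrow> smooth3 (\<lambda>x y t. F x y t + G x y t)"
  by (simp add: smooth3_iff_class_C class_C_add)

lemma smooth3_diff:
  assumes "smooth3 F" "smooth3 G"
  shows "smooth3 (\<lambda>x y t. F x y t - G x y t)"
  using smooth3_add[OF assms(1) smooth3_mult[OF smooth3_const[of "-1"] assms(2)]] by simp

lemma smooth3_swap: "smooth3 F \<Longrightarrow> smooth3 (swap F)"
  by (simp add: smooth3_iff_class_C class_C_swap)

lemma smooth3_pxi: "smooth3 F \<Longrightarrow> smooth3 (pxi F)"
  and smooth3_peta: "smooth3 F \<Longrightarrow> smooth3 (peta F)"
  using smooth3_pdir[of F Xi] smooth3_pdir[of F Eta] by auto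

lemmas smooth3_intros = smooth3_const smooth3_add smooth3_diff smooth3_mult smooth3_pxi smooth3_peta

lemma pdir_const: "pdir d (\<lambda>x y t. a) = (\<lambda>x y t. 0)"
  by (rule has_partial_pdir) (rule has_partial_const)

lemma pdir_add: "\<lbrakk>smooth3 F; smooth3 G\<rbrakk> \<Longrightarrow>
    pdir d (\<lambda>x y t. F x y t + G x y t) = (\<lambda>x y t. pdir d F x y t + pdir d G x y t)"
  by (intro has_partial_pdir has_partial_add smooth3_has_partial)

lemma pdir_diff: "\<lbrakk>smooth3 F; smooth3 G\<rbrakk> \<Longrightarrow>
    pdir d (\<lambda>x y t. F x y t - G x y t) = (\<lambda>x y t. pdir d F x y t - pdir d G x y t)"
  by (intro has_partial_pdir has_partial_diff smooth3_has_partial)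

lemma pdir_mult: "\<lbrakk>smooth3 F; smooth3 G\<rbrakk> \<Longrightarrow>
    pdir d (\<lambda>x y t. F x y t * G x y t) = (\<lambda>x y t. pdir d F x y t * G x y t + F x y t * pdir d G x y t)"
  by (intro has_partial_pdir has_partial_mult smooth3_has_partial)

lemmas pxi_rules = pdir_const[of Xi] pdir_add[of _ _ Xi] pdir_diff[of _ _ Xi] pdir_mult[of _ _ Xi]
lemmas peta_rules = pdir_const[of Eta] pdir_add[of _ _ Eta] pdir_diff[of _ _ Eta] pdir_mult[of _ _ Eta]

text \<open>Write \<open>F\<close> as its value at \<xi> = 0 plus the integral of its
  \<xi>-derivative, differentiate in \<eta> under the integral, and then in \<xi>, which undoes the
  integration and kills the boundary term.\<close>

lemma pxi_peta_commute:
  assumes "smooth3 F"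
  shows "pxi (peta F) = peta (pxi F)"
proof -
  have x: "has_partial Xi F (pxi F)" and y: "has_partial Eta F (peta F)"
    and xy: "has_partial Eta (pxi F) (peta (pxi F))"
    using assms smooth3_has_partial[of F Xi] smooth3_has_partial[of F Eta]
      smooth3_has_partial[OF smooth3_pxi, of F Eta] by auto
  have c: "cont3 (pxi F)" "cont3 (peta (pxi F))"
    using assms by (auto intro: smooth3_cont3 smooth3_intros)
  have "F = (\<lambda>x y t. F 0 y t + int_xi 0 (pxi F) x y t)"
    using int_xi_fundamental[OF x] by blast
  moreover have "has_partial Eta (\<lambda>x y t. F 0 y t + int_xi 0 (pxi F) x y t)
      (\<lambda>x y t. peta F 0 y t + int_xi 0 (peta (pxi F)) x y t)"
    using y by (intro has_partial_add int_xi_has_partial_param c xy) (auto simp: has_partial_def)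
  ultimately have "peta F = (\<lambda>x y t. peta F 0 y t + int_xi 0 (peta (pxi F)) x y t)"
    using has_partial_pdir by fastforce
  moreover have "has_partial Xi (\<lambda>x y t. peta F 0 y t + int_xi 0 (peta (pxi F)) x y t)
      (\<lambda>x y t. 0 + peta (pxi F) x y t)"
    by (intro has_partial_add int_xi_has_partial_Xi c) (simp add: has_partial_def)
  ultimately show ?thesis
    using has_partial_pdir by fastforce
qed

subsection \<open>The consistency conditions\<close>

text \<open>All derivatives of \<psi> and \<phi> cancel once the spatial equations are used, leaving
  an expression linear in \<psi> and \<phi>. The constant \<open>c\<close> stands for \<i> or -
  \<i>, so both conditions are served.\<close>

lemma cross_derivative_residual:
  fixes c :: complex
  assumes smooth: "smooth3 q1" "smooth3 q2" "smooth3 g1" "smooth3 g2" "smooth3 \<psi>" "smooth3 \<phi>"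
    and sys: "pxi \<psi> = (\<lambda>x y t. - (1/2) * q1 x y t * \<phi> x y t)"
      "peta \<phi> = (\<lambda>x y t. - (1/2) * q2 x y t * \<psi> x y t)"
    and c: "c * c = -1"
  shows "pxi (\<lambda>x y t. - c * (pxi (pxi \<psi>) x y t - peta (peta \<psi>) x y t
                 - g1 x y t * \<psi> x y t + pxi q1 x y t * \<phi> x y t)) x y t
      - (- (1/2) * (pt q1 x y t * \<phi> x y t
         + q1 x y t * (- c * (pxi (pxi \<phi>) x y t - peta (peta \<phi>) x y t
                 + g2 x y t * \<phi> x y t - peta q2 x y t * \<psi> x y t))))
    = - c * (1/2 * \<phi> x y t * (c * pt q1 x y t + pxi (pxi q1) x y t + peta (peta q1) x y t
                 + q1 x y t * (g1 x y t + g2 x y t))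
        - \<psi> x y t * (pxi g1 x y t + 1/2 * peta (\<lambda>x y t. q1 x y t * q2 x y t) x y t))"
proof -
  have cc: "c * (c * z) = - z" for z
    using c by (simp add: mult.assoc[symmetric])
  show ?thesis
    \<comment> \<open>Commuting moves \<open>pxi\<close> inside \<open>peta\<close> until it meets
      \<psi>, where the first spatial equation eliminates it.\<close>
    by (simp only: pxi_peta_commute sys pxi_rules[simplified] peta_rules[simplified] smooth smooth3_intros)
       (simp add: field_simps cc)
qed

theorem theorem3p2:
  fixes q1 q2 g1 g2 :: fn3
  assumes "smooth3 q1" "smooth3 q2" "smooth3 g1" "smooth3 g2"
  shows "consistent q1 q2 g1 g2 \<longleftrightarrow>
    (\<forall>x y t. \<i> * pt q1 x y t + pxi (pxi q1) x y t + peta (peta q1) x y t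
               + q1 x y t * (g1 x y t + g2 x y t) = 0)
  \<and> (\<forall>x y t. - \<i> * pt q2 x y t + pxi (pxi q2) x y t + peta (peta q2) x y t
               + q2 x y t * (g1 x y t + g2 x y t) = 0)
  \<and> (\<forall>x y t. pxi g1 x y t = - (1/2) * peta (\<lambda>x y t. q1 x y t * q2 x y t) x y t)
  \<and> (\<forall>x y t. peta g2 x y t = - (1/2) * pxi (\<lambda>x y t. q1 x y t * q2 x y t) x y t)"
proof -
  define E1 where "E1 = (\<lambda>x y t. \<i> * pt q1 x y t + pxi (pxi q1) x y t + peta (peta q1) x y t
               + q1 x y t * (g1 x y t + g2 x y t))"
  define E2 where "E2 = (\<lambda>x y t. - \<i> * pt q2 x y t + pxi (pxi q2) x y t + peta (peta q2) x y t
               + q2 x y t * (g1 x y t + g2 x y t))"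
  define G1 where "G1 = (\<lambda>x y t. pxi g1 x y t + 1/2 * peta (\<lambda>x y t. q1 x y t * q2 x y t) x y t)"
  define G2 where "G2 = (\<lambda>x y t. peta g2 x y t + 1/2 * pxi (\<lambda>x y t. q1 x y t * q2 x y t) x y t)"
  define P where "P = (\<lambda>\<psi> \<phi> x y t. - \<i> * (pxi (pxi \<psi>) x y t - peta (peta \<psi>) x y t
                 - g1 x y t * \<psi> x y t + pxi q1 x y t * \<phi> x y t))"
  define Q where "Q = (\<lambda>\<psi> \<phi> x y t. - \<i> * (pxi (pxi \<phi>) x y t - peta (peta \<phi>) x y t
                 + g2 x y t * \<phi> x y t - peta q2 x y t * \<psi> x y t))"
  \<comment> \<open>The spatial equations are stated between functions, not pointwise, so that they
    can be rewritten under further derivatives.\<close>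
  define sys where "sys \<psi> \<phi> \<longleftrightarrow> smooth3 \<psi> \<and> smooth3 \<phi> \<and>
      pxi \<psi> = (\<lambda>x y t. - (1/2) * q1 x y t * \<phi> x y t) \<and>
      peta \<phi> = (\<lambda>x y t. - (1/2) * q2 x y t * \<psi> x y t)" for \<psi> \<phi>
  have consistent: "consistent q1 q2 g1 g2 \<longleftrightarrow> (\<forall>\<psi> \<phi>. sys \<psi> \<phi> \<longrightarrow>
      (\<forall>x y t. pxi (P \<psi> \<phi>) x y t - (- (1/2) * (pt q1 x y t * \<phi> x y t + q1 x y t * Q \<psi> \<phi> x y t)) = 0) \<and>
      (\<forall>x y t. peta (Q \<psi> \<phi>) x y t - (- (1/2) * (pt q2 x y t * \<psi> x y t + q2 x y t * P \<psi> \<phi> x y t)) = 0))"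
    unfolding consistent_def sys_def P_def Q_def Let_def fun_eq_iff right_minus_eq by blast
  have r1: "pxi (P \<psi> \<phi>) x y t - (- (1/2) * (pt q1 x y t * \<phi> x y t + q1 x y t * Q \<psi> \<phi> x y t))
      = - \<i> * (1/2 * \<phi> x y t * E1 x y t - \<psi> x y t * G1 x y t)" if "sys \<psi> \<phi>" for \<psi> \<phi> x y t
    unfolding P_def Q_def E1_def G1_def
    by (rule cross_derivative_residual) (use that assms in \<open>auto simp: sys_def\<close>)
  \<comment> \<open>Exchanging \<open>\<xi>\<close> with \<open>\<eta>\<close> and \<open>\<psi>\<close> with \<open>\<phi>\<close> turns the system into itself with \<open>\<i>\<close> replaced by \<open>- \<i>\<close>.\<close>
  have r2: "peta (Q \<psi> \<phi>) x y t - (- (1/2) * (pt q2 x y t * \<psi> x y t + q2 x y t * P \<psi> \<phi> x y t))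
      = \<i> * (1/2 * \<psi> x y t * E2 x y t - \<phi> x y t * G2 x y t)" if s: "sys \<psi> \<phi>" for \<psi> \<phi> x y t
  proof -
    have sw: "pxi (swap F) = swap (peta F)" "peta (swap F) = swap (pxi F)" "pt (swap F) = swap (pt F)" for F
      by (simp_all add: swap_def pxi_def peta_def pt_def)
    \<comment> \<open>Reversing the factors turns the product of the swapped \<open>q2\<close> and
      \<open>q1\<close> back into the order \<open>q1\<close>, \<open>q2\<close> used in
      \<open>G2\<close>.\<close>
    have m: "(\<lambda>x y t. swap F x y t * swap G x y t) = swap (\<lambda>x y t. G x y t * F x y t)" for F G
      by (simp add: swap_def mult.commute)
    have Q: "(\<lambda>x y t. - (- \<i>) * (pxi (pxi (swap \<phi>)) x y t - peta (peta (swap \<phi>)) x y t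
          - swap g2 x y t * swap \<phi> x y t + pxi (swap q2) x y t * swap \<psi> x y t)) = swap (Q \<psi> \<phi>)"
      unfolding sw by (simp add: Q_def swap_def algebra_simps)
    have P: "- (- \<i>) * (pxi (pxi (swap \<psi>)) y x t - peta (peta (swap \<psi>)) y x t
          + swap g1 y x t * swap \<psi> y x t - peta (swap q1) y x t * swap \<phi> y x t) = P \<psi> \<phi> x y t"
      unfolding sw by (simp add: P_def swap_def algebra_simps)
    have "smooth3 (swap q2)" "smooth3 (swap q1)" "smooth3 (swap g2)" "smooth3 (swap g1)"
        "smooth3 (swap \<phi>)" "smooth3 (swap \<psi>)"
      using s assms by (auto simp: sys_def intro: smooth3_swap)
    moreover have "pxi (swap \<phi>) = (\<lambda>x y t. - (1/2) * swap q2 x y t * swap \<psi> x y t)"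
        "peta (swap \<psi>) = (\<lambda>x y t. - (1/2) * swap q1 x y t * swap \<phi> x y t)"
      using s unfolding sw by (auto simp: sys_def swap_def)
    moreover have "(- \<i>) * (- \<i>) = -1"
      by simp
    ultimately have "pxi (swap (Q \<psi> \<phi>)) y x t
        - (- (1/2) * (pt (swap q2) y x t * swap \<psi> y x t + swap q2 y x t * P \<psi> \<phi> x y t))
      = - (- \<i>) * (1/2 * swap \<psi> y x t * (- \<i> * pt (swap q2) y x t + pxi (pxi (swap q2)) y x t
            + peta (peta (swap q2)) y x t + swap q2 y x t * (swap g2 y x t + swap g1 y x t))
        - swap \<phi> y x t * (pxi (swap g2) y x t + 1/2 * peta (\<lambda>x y t. swap q2 x y t * swap q1 x y t) y x t))"
      using cross_derivative_residual[of "swap q2" "swap q1" "swap g2" "swap g1" "swap \<phi>" "swap \<psi>" "- \<i>" y x t]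
      unfolding Q P by blast
    then show ?thesis
      unfolding sw m by (simp add: swap_def E2_def G2_def algebra_simps)
  qed
  have vanish: "E1 x y t = 0 \<and> E2 x y t = 0 \<and> G1 x y t = 0 \<and> G2 x y t = 0"
    if "consistent q1 q2 g1 g2" for x y t
  proof -
    have sol: "\<exists>\<psi> \<phi>. sys \<psi> \<phi> \<and> \<psi> x y t = \<alpha> \<and> \<phi> x y t = \<beta>" for \<alpha> \<beta>
    proof -
      \<comment> \<open>The factor - 1/2 of the system is absorbed into the coefficients of the
        Goursat problem.\<close>
      have "smooth3 (\<lambda>x y t. - (1/2) * q1 x y t)" "smooth3 (\<lambda>x y t. - (1/2) * q2 x y t)"
        by (intro smooth3_mult smooth3_const assms)+
      from goursat_smooth_solution_through_point[OF this, of x y t \<alpha> \<beta>]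
      obtain \<psi> \<phi> where "smooth3 \<psi>" "smooth3 \<phi>"
          "pxi \<psi> = (\<lambda>x y t. - (1/2) * q1 x y t * \<phi> x y t)"
          "peta \<phi> = (\<lambda>x y t. - (1/2) * q2 x y t * \<psi> x y t)" "\<psi> x y t = \<alpha>" "\<phi> x y t = \<beta>" .
      then show ?thesis unfolding sys_def by (intro exI conjI)
    qed
    have eqs: "1/2 * \<phi> x y t * E1 x y t - \<psi> x y t * G1 x y t = 0"
        "1/2 * \<psi> x y t * E2 x y t - \<phi> x y t * G2 x y t = 0" if "sys \<psi> \<phi>" for \<psi> \<phi>
      using r1[OF that, of x y t] r2[OF that, of x y t] consistent \<open>consistent q1 q2 g1 g2\<close> that
      by auto
    \<comment> \<open>The values (1, 0) isolate \<open>G1\<close> and \<open>E2\<close>, the values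
      (0, 1) isolate \<open>E1\<close> and \<open>G2\<close>.\<close>
    obtain \<psi> \<phi> where "sys \<psi> \<phi>" "\<psi> x y t = 1" "\<phi> x y t = 0"
      using sol by blast
    moreover obtain \<psi>' \<phi>' where "sys \<psi>' \<phi>'" "\<psi>' x y t = 0" "\<phi>' x y t = 1"
      using sol by blast
    ultimately show ?thesis
      using eqs[of \<psi> \<phi>] eqs[of \<psi>' \<phi>'] by simp
  qed
  have "consistent q1 q2 g1 g2 \<longleftrightarrow> (\<forall>x y t. E1 x y t = 0) \<and> (\<forall>x y t. E2 x y t = 0)
      \<and> (\<forall>x y t. G1 x y t = 0) \<and> (\<forall>x y t. G2 x y t = 0)"
  proof
    assume "consistent q1 q2 g1 g2"
    then show "(\<forall>x y t. E1 x y t = 0) \<and> (\<forall>x y t. E2 x y t = 0)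
        \<and> (\<forall>x y t. G1 x y t = 0) \<and> (\<forall>x y t. G2 x y t = 0)"
      using vanish by blast
  next
    assume "(\<forall>x y t. E1 x y t = 0) \<and> (\<forall>x y t. E2 x y t = 0)
        \<and> (\<forall>x y t. G1 x y t = 0) \<and> (\<forall>x y t. G2 x y t = 0)"
    then show "consistent q1 q2 g1 g2"
      unfolding consistent by (intro allI impI conjI; subst r1 r2; simp)
  qed
  then show ?thesis
    unfolding E1_def E2_def G1_def G2_def by (simp only: eq_neg_iff_add_eq_0 mult_minus_left)
qed

end
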